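(* Let $K$ be a field, let $\lambda = (\lambda_1\ge \cdots\ge \lambda_m)$ be a partition with $\lambda_m\ge m$, put $n=\lambda_1$ and $R=K[x_1,\ldots,x_n]$, and let $I=(x_ix_j \mid 1\le i\le m,\ i\le j\le \lambda_i)\subseteq R$ be the associated strongly stable ideal generated in degree two. Let $\widehat I$ be its LCM-dual. Then the (total) Betti numbers $\beta_i=\beta_i(R/\widehat I)$ of $R/\widehat{I}$ are given by \begin{eqnarray*} \beta_1 &=& \lambda_1+ \cdots + \lambda_m - \binom{m}{2},\\ \beta_2 &=& \lambda_1 + 2(\lambda_2 + \cdots + \lambda_m) - m^2,\\ \beta_3 &=& \lambda_2 + \cdots + \lambda_m - \binom{m+1}{2} +1. \end{eqnarray*} Equivalently, writing $\mu(I)$ for the minimal number of generators of $I$ and $g=\operatorname{ht}(I)=m$, \begin{eqnarray*} \beta_1 &=& \mu(I),\\ \beta_2 &=& 2 \mu(I) -g -n,\\ \beta_3 &=& \mu(I) -g-n+1. \end{eqnarray*}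
   Context: LCM-dual: for a monomial ideal $I$ with minimal monomial generators $f_1,\ldots,f_\nu$ and $m_I=\operatorname{lcm}(f_1,\ldots,f_\nu)$, $\widehat I$ is the ideal generated by $m_I/f_1,\ldots,m_I/f_\nu$. (The ideal $I$ here is the specialization $\overline I_{\lambda-\mu}$, obtained by substituting $y_j\mapsto x_j$, of the generalized Ferrers ideal $I_{\lambda-\mu}=(x_iy_j\mid 1\le i\le m,\ i-1<j\le\lambda_i)$ with $\mu=(0,1,\ldots,m-1)$.) The total Betti number $\beta_i(R/\widehat I)$ is the rank of the $i$-th free module in the minimal graded free resolution of $R/\widehat I$ over $R$.
   Formalization: The case n = 1, that is λ = (1), is excluded: there I = (x_1^2), its LCM-dual is all of R, so R/Î = 0 and every Betti number is 0, whereas the stated formula gives β_1 = 1. *)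

theory Defs
  imports
    "HOL-Library.Multiset_Order"
    "HOL-Library.Poly_Mapping"
    "HOL-Library.Extended_Nat"
    "HOL-Algebra.QuotRing"
    "Jordan_Normal_Form.Matrix"
begin

text \<open>
  A monomial in the variables \<open>x\<^sub>i\<close> (\<open>i :: nat\<close>) is the multiset of its variables, so that
  \<open>{#i, j#}\<close> is \<open>x\<^sub>i x\<^sub>j\<close>, \<open>+\<close> is multiplication, \<open>\<subseteq>#\<close> is divisibility, \<open>-\<close> is exact division,
  and \<open>size\<close> is the total degree.  The multiplication on finitely supported functions
  (\<open>Poly_Mapping\<close>) is then the multiplication of polynomials.
\<close>

type_synonym 'k mpoly = "nat multiset \<Rightarrow>\<^sub>0 'k"

definition monomial :: "nat multiset \<Rightarrow> 'k::field mpoly" where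
  "monomial a = Poly_Mapping.single a 1"

text \<open>The polynomial ring \<open>K[x\<^sub>1,\<dots>,x\<^sub>n]\<close>.\<close>

definition poly_ring :: "nat \<Rightarrow> 'k::field mpoly ring" where
  "poly_ring n =
    \<lparr>carrier = {p. \<forall>a\<in>Poly_Mapping.keys p. set_mset a \<subseteq> {1..n}},
     monoid.mult = (*), one = 1, ring.zero = 0, add = (+)\<rparr>"

lemma poly_ring_simps [simp]:
  "p \<in> carrier (poly_ring n) \<longleftrightarrow> (\<forall>a\<in>Poly_Mapping.keys p. set_mset a \<subseteq> {1..n})"
  "p \<otimes>\<^bsub>poly_ring n\<^esub> q = p * q"
  "\<one>\<^bsub>poly_ring n\<^esub> = 1"
  "\<zero>\<^bsub>poly_ring n\<^esub> = 0"
  "p \<oplus>\<^bsub>poly_ring n\<^esub> q = p + q"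
  by (simp_all add: poly_ring_def)

lemma cring_poly_ring: "cring (poly_ring n :: 'k::field mpoly ring)"
proof (rule cringI)
  show "abelian_group (poly_ring n :: 'k mpoly ring)"
  proof (rule abelian_groupI)
    fix p q :: "'k mpoly"
    assume "p \<in> carrier (poly_ring n)" "q \<in> carrier (poly_ring n)"
    then show "p \<oplus>\<^bsub>poly_ring n\<^esub> q \<in> carrier (poly_ring n)"
      using Poly_Mapping.keys_add[of p q] by auto
  next
    fix p :: "'k mpoly"
    assume "p \<in> carrier (poly_ring n)"
    then have "- p \<in> carrier (poly_ring n)" "- p \<oplus>\<^bsub>poly_ring n\<^esub> p = \<zero>\<^bsub>poly_ring n\<^esub>"
      by (simp_all add: Poly_Mapping.keys_def)
    then show "\<exists>q\<in>carrier (poly_ring n). q \<oplus>\<^bsub>poly_ring n\<^esub> p = \<zero>\<^bsub>poly_ring n\<^esub>"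
      by blast
  qed (simp_all add: add.assoc add.commute)
  show "comm_monoid (poly_ring n :: 'k mpoly ring)"
  proof (rule comm_monoidI)
    fix p q :: "'k mpoly"
    assume pq: "p \<in> carrier (poly_ring n)" "q \<in> carrier (poly_ring n)"
    show "p \<otimes>\<^bsub>poly_ring n\<^esub> q \<in> carrier (poly_ring n)"
      unfolding poly_ring_simps
    proof
      fix c assume "c \<in> Poly_Mapping.keys (p * q)"
      then obtain a b where "c = a + b" "a \<in> Poly_Mapping.keys p" "b \<in> Poly_Mapping.keys q"
        using Poly_Mapping.keys_mult[of p q] by blast
      with pq show "set_mset c \<subseteq> {1..n}" by simp
    qed
  qed (simp_all add: mult.assoc mult.commute)
qed (simp add: distrib_right)


text \<open>
  For a monomial ideal \<open>I\<close>: the exponents of its minimal monomial generators, and its LCM-dual.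
  On finite nonempty sets of multisets, \<open>Sup\<close> is the join with respect to \<open>\<subseteq>#\<close>, i.e.\ the
  least common multiple.
\<close>

definition min_mono_gens :: "'k::field mpoly set \<Rightarrow> nat multiset set" where
  "min_mono_gens I =
    {a. monomial a \<in> I \<and> (\<forall>b. monomial b \<in> I \<longrightarrow> b \<subseteq># a \<longrightarrow> b = a)}"

definition lcm_dual :: "nat \<Rightarrow> 'k::field mpoly set \<Rightarrow> 'k mpoly set" where
  "lcm_dual n I =
    Idl\<^bsub>poly_ring n\<^esub> {monomial (Sup (min_mono_gens I) - f) | f. f \<in> min_mono_gens I}"

definition strongly_stable_ideal :: "nat \<Rightarrow> nat \<Rightarrow> (nat \<Rightarrow> nat) \<Rightarrow> 'k::field mpoly set" where
  "strongly_stable_ideal n m lam =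
    Idl\<^bsub>poly_ring n\<^esub> {monomial {#i, j#} | i j. 1 \<le> i \<and> i \<le> m \<and> i \<le> j \<and> j \<le> lam i}"


definition homogeneous :: "int \<Rightarrow> 'k::field mpoly \<Rightarrow> bool" where
  "homogeneous d p \<longleftrightarrow> (\<forall>a\<in>Poly_Mapping.keys p. int (size a) = d)"

definition irrelevant_ideal :: "nat \<Rightarrow> 'k::field mpoly set" where
  "irrelevant_ideal n = Idl\<^bsub>poly_ring n\<^esub> {monomial {#i#} | i. i \<in> {1..n}}"

definition free_module :: "nat \<Rightarrow> nat \<Rightarrow> 'k::field mpoly Matrix.vec set" where
  "free_module n r = {v \<in> carrier_vec r. \<forall>k<r. v $ k \<in> carrier (poly_ring n)}"

text \<open>
  Matrices of the degree-preserving \<open>R\<close>-linear maps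
  \<open>\<Oplus>\<^sub>k\<^sub><\<^sub>r R(-d k) \<rightarrow> \<Oplus>\<^sub>j\<^sub><\<^sub>s R(-e j)\<close>, \<open>R = K[x\<^sub>1,\<dots>,x\<^sub>n]\<close>.
\<close>

definition graded_maps ::
    "nat \<Rightarrow> nat \<Rightarrow> (nat \<Rightarrow> int) \<Rightarrow> nat \<Rightarrow> (nat \<Rightarrow> int) \<Rightarrow> 'k::field mpoly Matrix.mat set" where
  "graded_maps n r d s e =
    {A \<in> carrier_mat s r. \<forall>j<s. \<forall>k<r.
      A $$ (j, k) \<in> carrier (poly_ring n) \<and> homogeneous (d k - e j) (A $$ (j, k))}"

text \<open>
  A minimal graded free resolution
  \[ \cdots \to F_2 \to F_1 \to F_0 \to R/J \to 0 \]
  of \<open>R/J\<close>, for a homogeneous ideal \<open>J\<close> of \<open>R = K[x\<^sub>1,\<dots>,x\<^sub>n]\<close>.  Here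
  \<open>F\<^sub>i = \<Oplus>\<^sub>k\<^sub><\<^sub>b\<^sub>i R(-d i k)\<close>, the map \<open>F\<^sub>i\<^sub>+\<^sub>1 \<rightarrow> F\<^sub>i\<close> has the matrix \<open>D i\<close>, and the augmentation
  \<open>F\<^sub>0 \<rightarrow> R/J\<close> sends \<open>v\<close> to the class of \<open>u \<bullet> v\<close>, where \<open>u\<close> lifts the images of the basis vectors.
  Minimality is \<open>im (F\<^sub>i\<^sub>+\<^sub>1 \<rightarrow> F\<^sub>i) \<subseteq> (x\<^sub>1,\<dots>,x\<^sub>n) F\<^sub>i\<close>.
\<close>

definition min_graded_free_resolution ::
    "nat \<Rightarrow> 'k::field mpoly set \<Rightarrow> (nat \<Rightarrow> nat) \<Rightarrow> (nat \<Rightarrow> nat \<Rightarrow> int) \<Rightarrow>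
      (nat \<Rightarrow> 'k mpoly Matrix.mat) \<Rightarrow> 'k mpoly Matrix.vec \<Rightarrow> bool" where
  "min_graded_free_resolution n J b d D u \<longleftrightarrow>
    (\<forall>i. D i \<in> graded_maps n (b (Suc i)) (d (Suc i)) (b i) (d i)) \<and>
    u \<in> free_module n (b 0) \<and> (\<forall>k<b 0. homogeneous (d 0 k) (u $ k)) \<and>
    (\<lambda>v. J +>\<^bsub>poly_ring n\<^esub> (u \<bullet> v)) ` free_module n (b 0) = carrier (poly_ring n Quot J) \<and>
    {v \<in> free_module n (b 0). J +>\<^bsub>poly_ring n\<^esub> (u \<bullet> v) = \<zero>\<^bsub>poly_ring n Quot J\<^esub>} =
      (\<lambda>w. D 0 *\<^sub>v w) ` free_module n (b 1) \<and>
    (\<forall>i. {v \<in> free_module n (b (Suc i)). D i *\<^sub>v v = 0\<^sub>v (b i)} =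
      (\<lambda>w. D (Suc i) *\<^sub>v w) ` free_module n (b (Suc (Suc i)))) \<and>
    (\<forall>i. \<forall>j<b i. \<forall>k<b (Suc i). D i $$ (j, k) \<in> irrelevant_ideal n)"

text \<open>The total Betti number \<open>\<beta>\<^sub>i(R/J)\<close>.\<close>

definition betti :: "nat \<Rightarrow> 'k::field mpoly set \<Rightarrow> nat \<Rightarrow> nat" where
  "betti n J i = (THE r. \<exists>b d D u. min_graded_free_resolution n J b d D u \<and> b i = r)"


definition min_num_gens :: "('a, 'c) ring_scheme \<Rightarrow> 'a set \<Rightarrow> nat" where
  "min_num_gens R I =
    (LEAST k. \<exists>S. finite S \<and> card S = k \<and> S \<subseteq> carrier R \<and> I = Idl\<^bsub>R\<^esub> S)"

definition prime_height :: "('a, 'c) ring_scheme \<Rightarrow> 'a set \<Rightarrow> enat" where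
  "prime_height R P =
    Sup {enat k | k. \<exists>Q :: nat \<Rightarrow> 'a set.
      (\<forall>i\<le>k. primeideal (Q i) R) \<and> (\<forall>i<k. Q i \<subset> Q (Suc i)) \<and> Q k = P}"

definition ideal_height :: "('a, 'c) ring_scheme \<Rightarrow> 'a set \<Rightarrow> enat" where
  "ideal_height R I = (INF P\<in>{P. primeideal P R \<and> I \<subseteq> P}. prime_height R P)"

end

theory Submission
  imports Defs "Jordan_Normal_Form.Determinant"
begin

text \<open>
  Place the generator \<open>x\<^sub>i x\<^sub>j\<close> of the ideal at the lattice point
  \<open>(i, j)\<close>. The points form a shifted Ferrers diagram, and
  \<open>t / (x\<^sub>i x\<^sub>j)\<close>, with \<open>t\<close> the least common multiple
  of all generators, becomes the label of the point \<open>(i, j)\<close>. Two horizontal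
  neighbours have the label \<open>t / x\<^sub>i\<close> as least common multiple, two
  vertical neighbours have \<open>t / x\<^sub>j\<close>, and the four corners of a unit
  square have \<open>t\<close>. Hence the points, unit edges and unit squares of the diagram
  form a labelled two-dimensional cell complex, whose cellular complex has single variables
  (up to sign) as entries of its higher differentials. This complex is the minimal free
  resolution of the quotient by the LCM-dual, so its Betti numbers are numbers of cells, and
  they are counted row by row.

  Exactness is checked in each degree separately. At the points, the labels have linear
  quotients in row-major order: the leading coefficient of a syzygy lies in the ideal of the
  variables that the edges to the left and upper neighbours provide
  (\<open>vertex_syzygy_leading_coefficient\<close>, \<open>exact_vertices\<close>). At the
  edges, a cycle is the boundary of the combination of squares obtained by summing its
  coefficients on the horizontal edges down each column, each divided by the variable of its
  row (\<open>exact_edges\<close>). At the squares, a cycle vanishes by comparison with the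
  row above (\<open>exact_squares\<close>).

  That one minimal resolution determines the Betti numbers is the comparison theorem
  (\<open>min_free_resolution_unique\<close>): the composite of comparison maps is homotopic
  to the identity, and since all differentials have entries in the irrelevant ideal, it
  reduces to the identity over the field. The remaining two invariants are elementary. The
  quadratic generators span the degree-two part of the ideal, so no smaller set generates it
  (\<open>min_num_gens_equigenerated\<close>). A prime contains the ideal iff it contains
  \<open>x\<^sub>1, \<dots>, x\<^sub>m\<close>, so the height is that of
  \<open>(x\<^sub>1, \<dots>, x\<^sub>m)\<close>, which is \<open>m\<close> because chains
  of primes in \<open>n\<close> variables have length at most \<open>n\<close>
  (\<open>prime_chain_length_le\<close>).
\<close>

abbreviation polys :: "nat \<Rightarrow> 'k::field mpoly set" where
  "polys n \<equiv> carrier (poly_ring n)"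

abbreviation mons :: "'k::field mpoly \<Rightarrow> nat multiset set" where
  "mons p \<equiv> Poly_Mapping.keys p"

abbreviation coef :: "'k::field mpoly \<Rightarrow> nat multiset \<Rightarrow> 'k" where
  "coef p a \<equiv> Poly_Mapping.lookup p a"

abbreviation var :: "nat \<Rightarrow> 'k::field mpoly" where
  "var i \<equiv> monomial {#i#}"

section \<open>Coefficients of polynomials\<close>

lemma mons_iff: "a \<in> mons p \<longleftrightarrow> coef p a \<noteq> 0"
  by (simp add: in_keys_iff)

lemma mons_monomial [simp]: "mons (monomial a :: 'k::field mpoly) = {a}"
  by (simp add: monomial_def)

lemma coef_monomial: "coef (monomial a :: 'k::field mpoly) b = (if a = b then 1 else 0)"
  by (simp add: monomial_def lookup_single when_def)

lemma monomial_add: "monomial (a + b) = (monomial a * monomial b :: 'k::field mpoly)"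
  by (simp add: monomial_def mult_single)

lemma monomial_nonzero [simp]: "monomial a \<noteq> (0 :: 'k::field mpoly)"
  by (metis empty_not_insert keys_zero mons_monomial)

lemma coef_monomial_mult:
  "coef (monomial t * p :: 'k::field mpoly) a = (if t \<subseteq># a then coef p (a - t) else 0)"
proof -
  have "coef (monomial t * p) a = (\<Sum>q. coef p q when a = t + q)"
    by (simp add: lookup_mult monomial_def lookup_single when_mult)
  also have "\<dots> = (if t \<subseteq># a then coef p (a - t) else 0)"
  proof (cases "t \<subseteq># a")
    case True
    then have "a = t + q \<longleftrightarrow> a - t = q" for q
      by auto
    then show ?thesis using True by simp
  next
    case False
    then have "a \<noteq> t + q" for q by auto
    then show ?thesis using False by simp
  qed
  finally show ?thesis .
qed

lemma mons_monomial_mult: "mons (monomial t * p :: 'k::field mpoly) = (+) t ` mons p"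
proof (intro Set.set_eqI iffI)
  fix a assume "a \<in> mons (monomial t * p)"
  then have "t \<subseteq># a" "a - t \<in> mons p"
    by (auto simp: mons_iff coef_monomial_mult split: if_splits)
  then show "a \<in> (+) t ` mons p"
    by (intro image_eqI[of _ _ "a - t"]) auto
qed (auto simp: mons_iff coef_monomial_mult)

text \<open>
  A product of monomials is 1 only if both factors are 1, so taking the constant coefficient
  is a ring homomorphism onto the field: reduction modulo the irrelevant ideal.
\<close>

lemma coef_0_mult: "coef (p * q :: 'k::field mpoly) {#} = coef p {#} * coef q {#}"
proof -
  have "(\<Sum>q'. coef q q' when {#} = l + q') = (coef q {#} when l = {#})" for l
  proof (cases "l = {#}")
    case False
    then have "\<And>q'. {#} \<noteq> l + q'" by auto
    then show ?thesis using False by simp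
  qed simp
  then show ?thesis
    by (simp add: lookup_mult mult_when)
qed

lemma mpoly_eq_sum_monomials:
  "p = (\<Sum>a\<in>mons p. Poly_Mapping.single 0 (coef p a) * (monomial a :: 'k::field mpoly))"
proof (rule poly_mapping_eqI)
  fix b
  have "coef (\<Sum>a\<in>mons p. Poly_Mapping.single 0 (coef p a) * monomial a) b
      = (\<Sum>a\<in>mons p. if a = b then coef p a else 0)"
    by (auto simp: lookup_sum monomial_def mult_single lookup_single when_def intro!: sum.cong)
  then show "coef p b = coef (\<Sum>a\<in>mons p. Poly_Mapping.single 0 (coef p a) * monomial a) b"
    by (simp add: in_keys_iff)
qed

lemma coef_const_mult: "coef (Poly_Mapping.single 0 c * p :: 'k::field mpoly) a = c * coef p a"
  by (simp add: mult_map_scale_conv_mult[symmetric] Poly_Mapping.map.rep_eq when_def)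

lemma split_mons:
  fixes p :: "'k::field mpoly"
  obtains p' p'' where "p = p' + p''" "mons p' = mons p \<inter> S" "mons p'' = mons p - S"
proof
  define c where "c a = (if a \<in> S then coef p a else 0)" for a
  have fin: "finite {a. c a \<noteq> 0}"
    by (rule finite_subset[of _ "mons p"]) (auto simp: c_def mons_iff)
  then have c: "coef (Abs_poly_mapping c) = c" by simp
  show "p = Abs_poly_mapping c + (p - Abs_poly_mapping c)" by simp
  show "mons (Abs_poly_mapping c) = mons p \<inter> S"
    by (auto simp: mons_iff c) (auto simp: c_def split: if_splits)
  show "mons (p - Abs_poly_mapping c) = mons p - S"
    by (auto simp: mons_iff lookup_minus c) (auto simp: c_def split: if_splits)
qed

section \<open>Ideals of the polynomial ring\<close>

interpretation R: cring "poly_ring n :: 'k::field mpoly ring" for n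
  by (rule cring_poly_ring)

lemma polys_closed [simp, intro]:
  fixes p q :: "'k::field mpoly"
  shows "0 \<in> polys n" "1 \<in> polys n"
    "p \<in> polys n \<Longrightarrow> q \<in> polys n \<Longrightarrow> p + q \<in> polys n"
    "p \<in> polys n \<Longrightarrow> q \<in> polys n \<Longrightarrow> p * q \<in> polys n"
    "p \<in> polys n \<Longrightarrow> - p \<in> polys n"
    "p \<in> polys n \<Longrightarrow> q \<in> polys n \<Longrightarrow> p - q \<in> polys n"
proof -
  show neg: "- p \<in> polys n" if "p \<in> polys n" for p :: "'k mpoly"
    using that by (simp add: Poly_Mapping.keys_def)
  show "p - q \<in> polys n" if "p \<in> polys n" "q \<in> polys n"
    using R.a_closed[OF that(1) neg[OF that(2)]] unfolding poly_ring_simps(5) by simp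
  show "p + q \<in> polys n" if "p \<in> polys n" "q \<in> polys n"
    using R.a_closed[OF that] unfolding poly_ring_simps(5) .
  show "p * q \<in> polys n" if "p \<in> polys n" "q \<in> polys n"
    using R.m_closed[OF that] unfolding poly_ring_simps(2) .
qed auto

declare poly_ring_simps(1) [simp del]

lemma mem_polys: "p \<in> polys n \<longleftrightarrow> (\<forall>a\<in>mons p. set_mset a \<subseteq> {1..n})"
  by (rule poly_ring_simps(1))

lemma polys_sum [intro]: "(\<And>x. x \<in> A \<Longrightarrow> f x \<in> polys n) \<Longrightarrow> sum f A \<in> polys n"
  by (induction A rule: infinite_finite_induct) auto

lemma polys_power: "p \<in> polys n \<Longrightarrow> p ^ e \<in> polys n"
  by (induction e) auto

lemma polys_const [simp, intro]: "Poly_Mapping.single 0 c \<in> polys n"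
  by (simp add: mem_polys)

lemma monomial_in_polys [simp]: "(monomial a :: 'k::field mpoly) \<in> polys n \<longleftrightarrow> set_mset a \<subseteq> {1..n}"
  by (simp add: mem_polys)

lemma poly_ring_a_inv [simp]:
  assumes "(p :: 'k::field mpoly) \<in> polys n"
  shows "\<ominus>\<^bsub>poly_ring n\<^esub> p = - p"
  using assms by (intro R.minus_equality) auto

lemma poly_ring_a_minus [simp]:
  assumes "(q :: 'k::field mpoly) \<in> polys n"
  shows "p \<ominus>\<^bsub>poly_ring n\<^esub> q = p - q"
  using assms by (simp add: a_minus_def)

lemma poly_idealI:
  fixes Q :: "'k::field mpoly set"
  assumes "Q \<subseteq> polys n" "0 \<in> Q"
    and add: "\<And>p q. p \<in> Q \<Longrightarrow> q \<in> Q \<Longrightarrow> p + q \<in> Q"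
    and mult: "\<And>p r. p \<in> Q \<Longrightarrow> r \<in> polys n \<Longrightarrow> r * p \<in> Q"
  shows "ideal Q (poly_ring n)"
proof (rule idealI)
  have "- p \<in> Q" if "p \<in> Q" for p
    using mult[OF that, of "- 1"] by simp
  then show "subgroup Q (add_monoid (poly_ring n))"
    using assms by (intro R.add.subgroupI) (auto simp: a_inv_def[symmetric] subset_iff)
qed (use mult in \<open>auto simp: mult.commute R.ring_axioms\<close>)

context
  fixes Q :: "'k::field mpoly set" and n
  assumes Q: "ideal Q (poly_ring n)"
begin

lemma ideal_polysD: "p \<in> Q \<Longrightarrow> p \<in> polys n"
  using ideal.Icarr[OF Q] .

lemma ideal_polys_0: "0 \<in> Q"
  using additive_subgroup.zero_closed[OF ideal.axioms(1)[OF Q]] by simp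

lemma ideal_polys_add: "p \<in> Q \<Longrightarrow> q \<in> Q \<Longrightarrow> p + q \<in> Q"
  using additive_subgroup.a_closed[OF ideal.axioms(1)[OF Q]] by simp

lemma ideal_polys_mult: "p \<in> Q \<Longrightarrow> r \<in> polys n \<Longrightarrow> r * p \<in> Q"
  using ideal.I_l_closed[OF Q] by simp

lemma ideal_polys_sum: "(\<And>x. x \<in> A \<Longrightarrow> f x \<in> Q) \<Longrightarrow> sum f A \<in> Q"
  by (induction A rule: infinite_finite_induct) (auto intro: ideal_polys_add simp: ideal_polys_0)

lemma ideal_polys_diff: "p \<in> Q \<Longrightarrow> q \<in> Q \<Longrightarrow> p - q \<in> Q"
  using ideal_polys_add[OF _ ideal_polys_mult[of q "- 1"], of p] by simp

end

lemma Idl_finite_eq_combinations: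
  fixes f :: "'a \<Rightarrow> 'k::field mpoly"
  assumes fin: "finite V" and f: "\<And>v. v \<in> V \<Longrightarrow> f v \<in> polys n"
  shows "Idl\<^bsub>poly_ring n\<^esub> (f ` V) = {\<Sum>v\<in>V. f v * w v | w. \<forall>v. w v \<in> polys n}" (is "_ = ?C")
proof
  have sub: "f ` V \<subseteq> polys n" using f by auto
  note Q = R.genideal_ideal[OF sub]
  show "?C \<subseteq> Idl\<^bsub>poly_ring n\<^esub> (f ` V)"
  proof clarify
    fix w :: "'a \<Rightarrow> 'k mpoly" assume "\<forall>v. w v \<in> polys n"
    then have "w v * f v \<in> Idl\<^bsub>poly_ring n\<^esub> (f ` V)" if "v \<in> V" for v
      using R.genideal_self[OF sub] that by (intro ideal_polys_mult[OF Q]) auto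
    then show "(\<Sum>v\<in>V. f v * w v) \<in> Idl\<^bsub>poly_ring n\<^esub> (f ` V)"
      by (intro ideal_polys_sum[OF Q]) (simp add: mult.commute)
  qed
  have "ideal ?C (poly_ring n)"
  proof (rule poly_idealI)
    show "?C \<subseteq> polys n" using f by auto
    show "0 \<in> ?C" by (auto intro!: exI[of _ "\<lambda>_. 0"])
  next
    fix p q assume "p \<in> ?C" "q \<in> ?C"
    then obtain w w' where "p = (\<Sum>v\<in>V. f v * w v)" "q = (\<Sum>v\<in>V. f v * w' v)"
      "\<forall>v. w v \<in> polys n" "\<forall>v. w' v \<in> polys n" by blast
    then show "p + q \<in> ?C"
      by (auto intro!: exI[of _ "\<lambda>v. w v + w' v"] simp: algebra_simps sum.distrib)
  next
    fix p r :: "'k mpoly" assume "p \<in> ?C" "r \<in> polys n"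
    moreover then obtain w where "p = (\<Sum>v\<in>V. f v * w v)" "\<forall>v. w v \<in> polys n" by blast
    ultimately show "r * p \<in> ?C"
      by (auto intro!: exI[of _ "\<lambda>v. r * w v"] simp: algebra_simps sum_distrib_left)
  qed
  moreover have "f ` V \<subseteq> ?C"
  proof clarify
    fix v assume v: "v \<in> V"
    then have "f v = (\<Sum>v'\<in>V. f v' * (if v' = v then 1 else 0))"
      using fin by (simp add: if_distrib[of "(*) _"] cong: if_cong)
    then show "\<exists>w. f v = (\<Sum>v\<in>V. f v * w v) \<and> (\<forall>v. w v \<in> polys n)"
      by (intro exI[of _ "\<lambda>v'. if v' = v then 1 else 0"]) auto
  qed
  ultimately show "Idl\<^bsub>poly_ring n\<^esub> (f ` V) \<subseteq> ?C"
    by (rule R.genideal_minimal)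
qed

text \<open>This is how membership in an ideal, in particular in a prime, is reduced to monomials.\<close>

lemma ideal_contains_monomial_combinations:
  fixes Q :: "'k::field mpoly set"
  assumes Q: "ideal Q (poly_ring n)" and "\<And>a. a \<in> mons p \<Longrightarrow> monomial a \<in> Q"
  shows "p \<in> Q"
proof -
  have "(\<Sum>a\<in>mons p. Poly_Mapping.single 0 (coef p a) * (monomial a :: 'k mpoly)) \<in> Q"
    using assms(2) by (intro ideal_polys_sum[OF Q] ideal_polys_mult[OF Q]) auto
  then show ?thesis using mpoly_eq_sum_monomials[of p] by simp
qed

text \<open>
  The polynomials all of whose monomials are divisible by a generator form an ideal, and
  each of their monomials is visibly a multiple of a generator. All monomial ideals below
  are handled through this description.
\<close>

lemma Idl_monomials_eq:
  fixes G :: "nat multiset set"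
  assumes G: "\<And>g. g \<in> G \<Longrightarrow> set_mset g \<subseteq> {1..n}"
  shows "Idl\<^bsub>poly_ring n\<^esub> (monomial ` G) =
    {p :: 'k::field mpoly. p \<in> polys n \<and> (\<forall>a\<in>mons p. \<exists>g\<in>G. g \<subseteq># a)}" (is "_ = ?C")
proof
  have sub: "monomial ` G \<subseteq> (polys n :: 'k mpoly set)" using G by auto
  note Q = R.genideal_ideal[OF sub]
  show "?C \<subseteq> Idl\<^bsub>poly_ring n\<^esub> (monomial ` G)"
  proof (clarify, rule ideal_contains_monomial_combinations[OF Q])
    fix p :: "'k mpoly" and a
    assume p: "p \<in> polys n" "\<forall>a\<in>mons p. \<exists>g\<in>G. g \<subseteq># a" and a: "a \<in> mons p"
    then obtain g where g: "g \<in> G" "g \<subseteq># a" by blast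
    have "set_mset (a - g) \<subseteq> {1..n}"
      using p(1) a by (auto simp: mem_polys dest!: in_diffD)
    then have "monomial (a - g) * monomial g \<in> Idl\<^bsub>poly_ring n\<^esub> (monomial ` G :: 'k mpoly set)"
      using R.genideal_self[OF sub] g by (intro ideal_polys_mult[OF Q]) auto
    then show "monomial a \<in> Idl\<^bsub>poly_ring n\<^esub> (monomial ` G :: 'k mpoly set)"
      using g by (simp flip: monomial_add)
  qed
  have "ideal ?C (poly_ring n)"
  proof (rule poly_idealI)
    fix p q assume "p \<in> ?C" "q \<in> ?C"
    then show "p + q \<in> ?C" using keys_add[of p q] by auto
  next
    fix p r :: "'k mpoly" assume p: "p \<in> ?C" and r: "r \<in> polys n"
    have "\<exists>g\<in>G. g \<subseteq># c" if cm: "c \<in> mons (r * p)" for c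
    proof -
      obtain a b where c: "c = a + b" "b \<in> mons p"
        using cm keys_mult[of r p] by blast
      then obtain g where "g \<in> G" "g \<subseteq># b" using p by blast
      moreover have "b \<subseteq># c" using c by simp
      ultimately show ?thesis using subset_mset.order_trans by blast
    qed
    with p r show "r * p \<in> ?C" by auto
  qed auto
  then show "Idl\<^bsub>poly_ring n\<^esub> (monomial ` G) \<subseteq> ?C"
    by (rule R.genideal_minimal) (use G in auto)
qed

lemma irrelevant_ideal_eq:
  "irrelevant_ideal n = {p :: 'k::field mpoly. p \<in> polys n \<and> coef p {#} = 0}"
proof -
  have "irrelevant_ideal n = Idl\<^bsub>poly_ring n\<^esub> (monomial ` (\<lambda>i. {#i#}) ` {1..n} :: 'k mpoly set)"
    unfolding irrelevant_ideal_def by (rule arg_cong[of _ _ "genideal _"]) auto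
  also have "\<dots> = {p. p \<in> polys n \<and> (\<forall>a\<in>mons p. \<exists>g\<in>(\<lambda>i. {#i#}) ` {1..n}. g \<subseteq># a)}"
    by (rule Idl_monomials_eq) auto
  also have "\<dots> = {p. p \<in> polys n \<and> coef p {#} = 0}"
  proof (intro Collect_cong conj_cong refl)
    fix p :: "'k mpoly" assume p: "p \<in> polys n"
    show "(\<forall>a\<in>mons p. \<exists>g\<in>(\<lambda>i. {#i#}) ` {1..n}. g \<subseteq># a) \<longleftrightarrow> coef p {#} = 0"
    proof
      assume "\<forall>a\<in>mons p. \<exists>g\<in>(\<lambda>i. {#i#}) ` {1..n}. g \<subseteq># a"
      then have "{#} \<notin> mons p" by force
      then show "coef p {#} = 0" by (simp add: mons_iff)
    next
      assume "coef p {#} = 0"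
      show "\<forall>a\<in>mons p. \<exists>g\<in>(\<lambda>i. {#i#}) ` {1..n}. g \<subseteq># a"
      proof
        fix a assume a: "a \<in> mons p"
        with \<open>coef p {#} = 0\<close> have "a \<noteq> {#}" by (auto simp: mons_iff)
        then obtain i where "i \<in># a" by blast
        moreover from this have "i \<in> {1..n}" using p a unfolding mem_polys by blast
        ultimately show "\<exists>g\<in>(\<lambda>i. {#i#}) ` {1..n}. g \<subseteq># a" by auto
      qed
    qed
  qed
  finally show ?thesis .
qed

section \<open>Division by a variable\<close>

text \<open>
  Division by \<open>x\<^sub>i\<close> that drops the monomials not divisible by
  \<open>x\<^sub>i\<close>. Being total, it allows candidates for quotients to be written
  down before divisibility is known.
\<close>

definition var_quot :: "nat \<Rightarrow> 'k::field mpoly \<Rightarrow> 'k mpoly" where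
  "var_quot i p = Poly_Mapping.map_key (add_mset i) p"

lemma coef_var_quot: "coef (var_quot i p) a = coef p (add_mset i a)"
  by (simp add: var_quot_def map_key.rep_eq inj_def)

lemma mons_var_quot: "mons (var_quot i p) = {a. add_mset i a \<in> mons p}"
  by (auto simp: mons_iff coef_var_quot)

lemma var_quot_in_polys [simp]: "p \<in> polys n \<Longrightarrow> var_quot i p \<in> polys n"
  by (fastforce simp: mem_polys mons_var_quot)

lemma var_quot_mult [simp]: "var_quot i (var i * p) = p"
  by (rule poly_mapping_eqI) (simp add: coef_var_quot coef_monomial_mult)

lemma var_quot_0 [simp]: "var_quot i 0 = 0"
  by (rule poly_mapping_eqI) (simp add: coef_var_quot)

lemma var_mult_var_quot:
  assumes "\<And>a. a \<in> mons p \<Longrightarrow> i \<in># a"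
  shows "var i * var_quot i p = p"
proof (rule poly_mapping_eqI)
  fix a
  show "coef (var i * var_quot i p) a = coef p a"
    using assms[of a] by (auto simp: coef_monomial_mult coef_var_quot mons_iff)
qed

text \<open>
  Distinct variables are coprime: this replaces unique factorization in the analysis of
  cycles.
\<close>

lemma var_multiple_other_var:
  assumes "var i * p = var j * (q :: 'k::field mpoly)" "i \<noteq> j"
  shows "var i * var_quot i q = q"
proof (rule var_mult_var_quot)
  fix a assume "a \<in> mons q"
  then have "{#j#} + a \<in> mons (var i * p)"
    unfolding assms(1) mons_monomial_mult by (rule imageI)
  then obtain b where "{#j#} + a = {#i#} + b"
    unfolding mons_monomial_mult by blast
  then have "i \<in># {#j#} + a" by simp
  with \<open>i \<noteq> j\<close> show "i \<in># a" by simp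
qed

section \<open>Dimension counting over a field\<close>

text \<open>
  Padded with zero rows to a square matrix, \<open>A\<close> has determinant 0, because the
  transpose kills a unit vector.
\<close>

lemma nontrivial_kernel:
  fixes A :: "'k::field mat"
  assumes A: "A \<in> carrier_mat p q" and pq: "p < q"
  shows "\<exists>v\<in>carrier_vec q. v \<noteq> 0\<^sub>v q \<and> A *\<^sub>v v = 0\<^sub>v p"
proof -
  define B where "B = mat q q (\<lambda>(i, j). if i < p then A $$ (i, j) else 0)"
  have B: "B \<in> carrier_mat q q" by (simp add: B_def)
  have "B\<^sup>T *\<^sub>v unit_vec q p = 0\<^sub>v q"
    using pq by (auto simp: B_def scalar_prod_def unit_vec_def intro!: eq_vecI sum.neutral)
  moreover have "unit_vec q p \<noteq> (0\<^sub>v q :: 'k vec)"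
    using pq by (metis index_unit_vec(1) index_zero_vec(1) one_neq_zero)
  ultimately have "det (B\<^sup>T) = 0"
    using det_0_iff_vec_prod_zero_field[of "B\<^sup>T" q] B by (metis transpose_carrier_mat unit_vec_carrier)
  then have "det B = 0" using det_transpose[OF B] by simp
  then obtain v where v: "v \<in> carrier_vec q" "v \<noteq> 0\<^sub>v q" "B *\<^sub>v v = 0\<^sub>v q"
    using det_0_iff_vec_prod_zero_field[OF B] by blast
  have "A *\<^sub>v v = 0\<^sub>v p"
  proof (rule eq_vecI)
    fix i assume "i < dim_vec (0\<^sub>v p :: 'k vec)"
    then have i: "i < p" by simp
    have "row A i = row B i" using i A pq by (intro eq_vecI) (auto simp: B_def)
    then have "(A *\<^sub>v v) $ i = (B *\<^sub>v v) $ i" using i A B pq by simp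
    then show "(A *\<^sub>v v) $ i = 0\<^sub>v p $ i" using i v(3) pq by simp
  qed (use A in simp)
  with v show ?thesis by blast
qed

lemma nontrivial_solution:
  fixes M :: "'a \<Rightarrow> 'b \<Rightarrow> 'k::field"
  assumes X: "finite X" and Y: "finite Y" and less: "card X < card Y"
  shows "\<exists>c. (\<exists>y\<in>Y. c y \<noteq> 0) \<and> (\<forall>x\<in>X. (\<Sum>y\<in>Y. M x y * c y) = 0)"
proof -
  obtain e where e: "bij_betw e {..<card X} X"
    using ex_bij_betw_nat_finite[OF X] atLeast0LessThan by metis
  obtain f where f: "bij_betw f {..<card Y} Y"
    using ex_bij_betw_nat_finite[OF Y] atLeast0LessThan by metis
  define A where "A = mat (card X) (card Y) (\<lambda>(i, j). M (e i) (f j))"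
  obtain v where v: "v \<in> carrier_vec (card Y)" "v \<noteq> 0\<^sub>v (card Y)" "A *\<^sub>v v = 0\<^sub>v (card X)"
    using nontrivial_kernel[of A "card X" "card Y"] less by (auto simp: A_def)
  define c where "c y = v $ (the_inv_into {..<card Y} f y)" for y
  have c: "c (f j) = v $ j" if "j < card Y" for j
    using the_inv_into_f_f[of f "{..<card Y}" j] f that by (auto simp: c_def bij_betw_def)
  have "\<exists>j<card Y. v $ j \<noteq> 0"
  proof (rule ccontr)
    assume "\<not> ?thesis"
    then have "v = 0\<^sub>v (card Y)" using v(1) by (intro eq_vecI) auto
    with v(2) show False by simp
  qed
  then obtain j where j: "j < card Y" "v $ j \<noteq> 0" by blast
  have "f j \<in> Y" using f j(1) by (auto simp: bij_betw_def)
  with j c have "\<exists>y\<in>Y. c y \<noteq> 0" by metis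
  moreover have "(\<Sum>y\<in>Y. M x y * c y) = 0" if "x \<in> X" for x
  proof -
    have "x \<in> e ` {..<card X}" using e that by (simp add: bij_betw_def)
    then obtain i where i: "i < card X" "x = e i" by auto
    have "(\<Sum>y\<in>Y. M x y * c y) = (\<Sum>j<card Y. M x (f j) * c (f j))"
      using sum.reindex_bij_betw[OF f, of "\<lambda>y. M x y * c y"] by simp
    also have "\<dots> = (A *\<^sub>v v) $ i"
      using i v(1) c by (auto simp: A_def scalar_prod_def atLeast0LessThan intro!: sum.cong)
    finally show ?thesis using v(3) i by simp
  qed
  ultimately show ?thesis by blast
qed

lemma right_inverse_imp_dim_le:
  fixes A :: "'k::field mat"
  assumes A: "A \<in> carrier_mat p q" and B: "B \<in> carrier_mat q p" and AB: "A * B = 1\<^sub>m p"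
  shows "p \<le> q"
proof (rule ccontr)
  assume "\<not> p \<le> q"
  then obtain v where v: "v \<in> carrier_vec p" "v \<noteq> 0\<^sub>v p" "B *\<^sub>v v = 0\<^sub>v q"
    using nontrivial_kernel[OF B] by auto
  have "v = (A * B) *\<^sub>v v" using AB v(1) by simp
  also have "\<dots> = A *\<^sub>v (B *\<^sub>v v)" using A B v(1) by (rule assoc_mult_mat_vec)
  also have "\<dots> = 0\<^sub>v p" using A v(3) by auto
  finally show False using v(2) by simp
qed

section \<open>Matrices over the polynomial ring\<close>

definition poly_mats :: "nat \<Rightarrow> nat \<Rightarrow> nat \<Rightarrow> 'k::field mpoly mat set" where
  "poly_mats n p q = {A \<in> carrier_mat p q. \<forall>i<p. \<forall>j<q. A $$ (i, j) \<in> polys n}"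

lemma poly_mats_carrier: "A \<in> poly_mats n p q \<Longrightarrow> A \<in> carrier_mat p q"
  by (simp add: poly_mats_def)

lemma free_module_carrier: "v \<in> free_module n r \<Longrightarrow> v \<in> carrier_vec r"
  by (simp add: free_module_def)

lemma poly_mats_mult:
  assumes "A \<in> poly_mats n p q" "B \<in> poly_mats n q r"
  shows "A * B \<in> poly_mats n p r"
  using assms by (auto simp: poly_mats_def scalar_prod_def intro!: polys_sum)

lemma poly_mats_minus:
  assumes "A \<in> poly_mats n p q" "B \<in> poly_mats n p q"
  shows "A - B \<in> poly_mats n p q"
  using assms by (auto simp: poly_mats_def)

lemma poly_mats_one: "1\<^sub>m p \<in> poly_mats n p p"
  by (auto simp: poly_mats_def)

lemma poly_mats_mult_vec:
  assumes "A \<in> poly_mats n p q" "v \<in> free_module n q"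
  shows "A *\<^sub>v v \<in> free_module n p"
  using assms by (auto simp: poly_mats_def free_module_def scalar_prod_def intro!: polys_sum)

lemma unit_vec_free_module: "unit_vec r k \<in> free_module n r"
  by (auto simp: free_module_def unit_vec_def)

lemma mat_mult_unit_vec:
  assumes "(A :: 'a::comm_ring_1 mat) \<in> carrier_mat p q" "k < q"
  shows "A *\<^sub>v unit_vec q k = col A k"
  using assms by (intro eq_vecI) (auto simp: scalar_prod_right_unit)

lemma poly_mats_eqI:
  assumes "A \<in> poly_mats n p q" "B \<in> poly_mats n p q"
    and eq: "\<And>v. v \<in> free_module n q \<Longrightarrow> A *\<^sub>v v = B *\<^sub>v v"
  shows "A = B"
proof (rule mat_col_eqI)
  fix k assume "k < dim_col B"
  then show "col A k = col B k"
    using eq[OF unit_vec_free_module[of q k]] assms(1,2)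
    by (auto simp: poly_mats_def mat_mult_unit_vec)
qed (use assms in \<open>auto simp: poly_mats_def\<close>)

text \<open>
  A free module is projective: preimages of the basis vectors are chosen and used as
  columns.
\<close>

lemma poly_mats_factor:
  fixes B D :: "'k::field mpoly mat"
  assumes B: "B \<in> poly_mats n p q" and D: "D \<in> poly_mats n p r"
    and im: "\<And>v. v \<in> free_module n q \<Longrightarrow> B *\<^sub>v v \<in> (\<lambda>w. D *\<^sub>v w) ` free_module n r"
  shows "\<exists>H\<in>poly_mats n r q. B = D * H"
proof -
  have "\<forall>k. \<exists>w\<in>free_module n r. B *\<^sub>v unit_vec q k = D *\<^sub>v w"
    using im[OF unit_vec_free_module] by blast
  then obtain w where w: "\<And>k. w k \<in> free_module n r" "\<And>k. B *\<^sub>v unit_vec q k = D *\<^sub>v w k"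
    by metis
  define H where "H = mat r q (\<lambda>(i, k). w k $ i)"
  have colH: "col H k = w k" if "k < q" for k
    using that free_module_carrier[OF w(1)[of k]] by (intro eq_vecI) (auto simp: H_def)
  have H: "H \<in> poly_mats n r q"
    using w(1) by (auto simp: poly_mats_def free_module_def H_def)
  moreover have "B = D * H"
  proof (rule mat_col_eqI)
    fix k assume "k < dim_col (D * H)"
    then have k: "k < q" by (simp add: H_def)
    have "col B k = B *\<^sub>v unit_vec q k"
      using mat_mult_unit_vec[OF poly_mats_carrier[OF B] k] by simp
    also have "\<dots> = D *\<^sub>v col H k" using w(2) colH[OF k] by simp
    also have "\<dots> = col (D * H) k"
      using D H k by (intro eq_vecI) (auto simp: poly_mats_def)
    finally show "col B k = col (D * H) k" .
  qed (use B D H in \<open>auto simp: poly_mats_def\<close>)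
  ultimately show ?thesis by blast
qed

abbreviation const_coef :: "'k::field mpoly \<Rightarrow> 'k" where
  "const_coef p \<equiv> coef p {#}"

interpretation const_coef: comm_ring_hom "const_coef :: 'k::field mpoly \<Rightarrow> 'k"
proof
  show "const_coef (1 :: 'k mpoly) = 1" using coef_monomial[of "{#}" "{#}"] by simp
qed (simp_all add: lookup_add coef_0_mult)

section \<open>Uniqueness of minimal free resolutions\<close>

text \<open>
  The kernel at homological degree \<open>i\<close>, where the kernel of the augmentation to
  the quotient by \<open>J\<close> is the one at degree 0. Treating both cases alike lets
  each step below be stated once.
\<close>

definition cycles ::
    "nat \<Rightarrow> 'k::field mpoly set \<Rightarrow> (nat \<Rightarrow> nat) \<Rightarrow> (nat \<Rightarrow> 'k mpoly mat) \<Rightarrow> 'k mpoly vec \<Rightarrow>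
      nat \<Rightarrow> 'k mpoly vec set" where
  "cycles n J b D u i = (case i of
     0 \<Rightarrow> {v \<in> free_module n (b 0). u \<bullet> v \<in> J}
   | Suc j \<Rightarrow> {v \<in> free_module n (b (Suc j)). D j *\<^sub>v v = 0\<^sub>v (b j)})"

locale min_free_resolution =
  fixes n :: nat and J :: "'k::field mpoly set" and b D u
  assumes J: "ideal J (poly_ring n)"
    and D: "D i \<in> poly_mats n (b i) (b (Suc i))"
    and u: "u \<in> free_module n (b 0)"
    and onto: "x \<in> polys n \<Longrightarrow> \<exists>v\<in>free_module n (b 0). u \<bullet> v - x \<in> J"
    and exact: "cycles n J b D u i = (\<lambda>w. D i *\<^sub>v w) ` free_module n (b (Suc i))"
    and minimal: "j < b i \<Longrightarrow> k < b (Suc i) \<Longrightarrow> const_coef (D i $$ (j, k)) = 0"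
begin

lemma D_D: "D i * D (Suc i) = 0\<^sub>m (b i) (b (Suc (Suc i)))"
proof (rule poly_mats_eqI)
  fix v :: "'k mpoly vec" assume v: "v \<in> free_module n (b (Suc (Suc i)))"
  then have "D (Suc i) *\<^sub>v v \<in> cycles n J b D u (Suc i)" unfolding exact by blast
  then have "D i *\<^sub>v (D (Suc i) *\<^sub>v v) = 0\<^sub>v (b i)" by (simp add: cycles_def)
  moreover have "0\<^sub>m (b i) (b (Suc (Suc i))) *\<^sub>v v = 0\<^sub>v (b i)"
    using free_module_carrier[OF v] by (intro eq_vecI) auto
  ultimately show "D i * D (Suc i) *\<^sub>v v = 0\<^sub>m (b i) (b (Suc (Suc i))) *\<^sub>v v"
    using assoc_mult_mat_vec[OF poly_mats_carrier[OF D] poly_mats_carrier[OF D] free_module_carrier[OF v]]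
    by simp
qed (use D in \<open>auto intro: poly_mats_mult\<close>, auto simp: poly_mats_def)

lemma in_cycles_0: "v \<in> cycles n J b D u 0 \<longleftrightarrow> v \<in> free_module n (b 0) \<and> u \<bullet> v \<in> J"
  by (simp add: cycles_def)

lemma in_cycles_Suc:
  "v \<in> cycles n J b D u (Suc i) \<longleftrightarrow> v \<in> free_module n (b (Suc i)) \<and> D i *\<^sub>v v = 0\<^sub>v (b i)"
  by (simp add: cycles_def)

lemma D_vec_in_cycles: "w \<in> free_module n (b (Suc i)) \<Longrightarrow> D i *\<^sub>v w \<in> cycles n J b D u i"
  unfolding exact by blast

lemma factor_through_D:
  assumes "B \<in> poly_mats n (b i) q" "\<And>v. v \<in> free_module n q \<Longrightarrow> B *\<^sub>v v \<in> cycles n J b D u i"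
  shows "\<exists>H\<in>poly_mats n (b (Suc i)) q. B = D i * H"
  using assms(2) by (intro poly_mats_factor[OF assms(1) D]) (auto simp: exact)

lemma const_coef_D: "map_mat const_coef (D i) = 0\<^sub>m (b i) (b (Suc i))"
  using minimal[of _ i] poly_mats_carrier[OF D[of i]] by (intro eq_matI) auto

end

text \<open>
  If \<open>P\<close> maps cycles to cycles, the columns of \<open>P D\<close> are cycles of
  the second resolution, hence boundaries, and lifting them yields the comparison map in the
  next degree.
\<close>

lemma comparison_step:
  assumes F: "min_free_resolution n J b D u" and G: "min_free_resolution n J b' D' u'"
    and P: "P \<in> poly_mats n (b' i) (b i)"
    and PZ: "\<And>v. v \<in> cycles n J b D u i \<Longrightarrow> P *\<^sub>v v \<in> cycles n J b' D' u' i"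
  shows "\<exists>P'\<in>poly_mats n (b' (Suc i)) (b (Suc i)). P * D i = D' i * P' \<and>
    (\<forall>v\<in>cycles n J b D u (Suc i). P' *\<^sub>v v \<in> cycles n J b' D' u' (Suc i))"
proof -
  interpret F: min_free_resolution n J b D u by fact
  interpret G: min_free_resolution n J b' D' u' by fact
  have "P * D i *\<^sub>v v \<in> cycles n J b' D' u' i" if "v \<in> free_module n (b (Suc i))" for v
    using PZ[OF F.D_vec_in_cycles[OF that]]
    by (simp add: assoc_mult_mat_vec[OF poly_mats_carrier[OF P] poly_mats_carrier[OF F.D]
          free_module_carrier[OF that]])
  then obtain P' where P': "P' \<in> poly_mats n (b' (Suc i)) (b (Suc i))" "P * D i = D' i * P'"
    using G.factor_through_D[OF poly_mats_mult[OF P F.D]] by blast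
  have "P' *\<^sub>v v \<in> cycles n J b' D' u' (Suc i)" if "v \<in> cycles n J b D u (Suc i)" for v
  proof -
    from that have v: "v \<in> free_module n (b (Suc i))" "D i *\<^sub>v v = 0\<^sub>v (b i)"
      by (simp_all add: F.in_cycles_Suc)
    note vc = free_module_carrier[OF v(1)]
    have "D' i *\<^sub>v (P' *\<^sub>v v) = P *\<^sub>v (D i *\<^sub>v v)"
      using assoc_mult_mat_vec[OF poly_mats_carrier[OF G.D] poly_mats_carrier[OF P'(1)] vc]
        assoc_mult_mat_vec[OF poly_mats_carrier[OF P] poly_mats_carrier[OF F.D] vc] P'(2) by simp
    also have "\<dots> = 0\<^sub>v (b' i)"
      using v(2) poly_mats_carrier[OF P] by (intro eq_vecI) auto
    finally show ?thesis
      using poly_mats_mult_vec[OF P'(1) v(1)] by (simp add: G.in_cycles_Suc)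
  qed
  with P' show ?thesis by blast
qed

lemma comparison_start:
  assumes F: "min_free_resolution n J b D u" and G: "min_free_resolution n J b' D' u'"
  shows "\<exists>P\<in>poly_mats n (b' 0) (b 0).
    (\<forall>v\<in>free_module n (b 0). u' \<bullet> (P *\<^sub>v v) - u \<bullet> v \<in> J)"
proof -
  interpret F: min_free_resolution n J b D u by fact
  interpret G: min_free_resolution n J b' D' u' by fact
  have "\<forall>k. \<exists>w\<in>free_module n (b' 0). k < b 0 \<longrightarrow> u' \<bullet> w - u $ k \<in> J"
  proof
    fix k
    show "\<exists>w\<in>free_module n (b' 0). k < b 0 \<longrightarrow> u' \<bullet> w - u $ k \<in> J"
    proof (cases "k < b 0")
      case True
      then show ?thesis using F.u G.onto[of "u $ k"] by (auto simp: free_module_def)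
    next
      case False
      then show ?thesis using G.onto[of 0] by auto
    qed
  qed
  then obtain w where w: "\<And>k. w k \<in> free_module n (b' 0)"
    "\<And>k. k < b 0 \<Longrightarrow> u' \<bullet> w k - u $ k \<in> J"
    by metis
  (* Basis vectors are sent to vectors with the same image in the quotient by J, up to elements
     of J. *)
  define P where "P = mat (b' 0) (b 0) (\<lambda>(i, k). w k $ i)"
  have Pc: "P \<in> carrier_mat (b' 0) (b 0)" by (simp add: P_def)
  have P: "P \<in> poly_mats n (b' 0) (b 0)"
    using w(1) by (auto simp: poly_mats_def free_module_def P_def)
  have colP: "col P k = w k" if "k < b 0" for k
    using that free_module_carrier[OF w(1)[of k]] by (intro eq_vecI) (auto simp: P_def)
  have "u' \<bullet> (P *\<^sub>v v) - u \<bullet> v \<in> J" if v: "v \<in> free_module n (b 0)" for v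
  proof -
    note vc = free_module_carrier[OF v] and uc = free_module_carrier[OF G.u]
    have "u' \<bullet> (P *\<^sub>v v) = (P\<^sup>T *\<^sub>v u') \<bullet> v"
      using transpose_vec_mult_scalar[OF Pc vc uc] by simp
    also have "\<dots> = (\<Sum>k<b 0. (u' \<bullet> w k) * v $ k)"
      using vc Pc uc colP comm_scalar_prod[OF uc free_module_carrier[OF w(1)]]
      by (simp add: scalar_prod_def[of _ v] atLeast0LessThan)
    finally have "u' \<bullet> (P *\<^sub>v v) - u \<bullet> v = (\<Sum>k<b 0. v $ k * (u' \<bullet> w k - u $ k))"
      using vc by (simp add: scalar_prod_def[of u] atLeast0LessThan sum_subtractf algebra_simps)
    moreover have "v $ k * (u' \<bullet> w k - u $ k) \<in> J" if "k < b 0" for k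
      using w(2)[OF that] v that by (intro ideal_polys_mult[OF F.J]) (auto simp: free_module_def)
    ultimately show ?thesis by (auto intro!: ideal_polys_sum[OF F.J])
  qed
  with P show ?thesis by blast
qed

text \<open>
  Write \<open>C = Q P - 1\<close>. The map \<open>C - h D\<close> in degree
  \<open>i + 1\<close>, formed with the homotopy of degree \<open>i\<close>, has values in
  cycles and factors as \<open>D h'\<close>. Hence \<open>C = h D + D h'\<close> has all its
  entries in the irrelevant ideal. The induction carries along exactly the data that the
  next step needs, so that no sequence of maps has to be chosen.
\<close>

lemma comparison_homotopy:
  assumes F: "min_free_resolution n J b D u" and G: "min_free_resolution n J b' D' u'"
  shows "\<exists>P\<in>poly_mats n (b' i) (b i). \<exists>Q\<in>poly_mats n (b i) (b' i).
      \<exists>h\<in>poly_mats n (b (Suc i)) (b i).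
    (\<forall>v\<in>cycles n J b D u i. P *\<^sub>v v \<in> cycles n J b' D' u' i) \<and>
    (\<forall>v\<in>cycles n J b' D' u' i. Q *\<^sub>v v \<in> cycles n J b D u i) \<and>
    (Q * P - 1\<^sub>m (b i) - D i * h) * D i = 0\<^sub>m (b i) (b (Suc i)) \<and>
    map_mat const_coef (Q * P - 1\<^sub>m (b i)) = 0\<^sub>m (b i) (b i)"
proof (induction i)
  case 0
  interpret F: min_free_resolution n J b D u by fact
  interpret G: min_free_resolution n J b' D' u' by fact
  obtain P where P: "P \<in> poly_mats n (b' 0) (b 0)"
    "\<And>v. v \<in> free_module n (b 0) \<Longrightarrow> u' \<bullet> (P *\<^sub>v v) - u \<bullet> v \<in> J"
    using comparison_start[OF F G] by blast
  obtain Q where Q: "Q \<in> poly_mats n (b 0) (b' 0)"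
    "\<And>v. v \<in> free_module n (b' 0) \<Longrightarrow> u \<bullet> (Q *\<^sub>v v) - u' \<bullet> v \<in> J"
    using comparison_start[OF G F] by blast
  note Pc = poly_mats_carrier[OF P(1)] and Qc = poly_mats_carrier[OF Q(1)]
    and uc = free_module_carrier[OF F.u]
  have PZ: "P *\<^sub>v v \<in> cycles n J b' D' u' 0" if "v \<in> cycles n J b D u 0" for v
    using that ideal_polys_add[OF F.J P(2), of v "u \<bullet> v"] poly_mats_mult_vec[OF P(1)]
    by (auto simp: F.in_cycles_0 G.in_cycles_0)
  have QZ: "Q *\<^sub>v v \<in> cycles n J b D u 0" if "v \<in> cycles n J b' D' u' 0" for v
    using that ideal_polys_add[OF F.J Q(2), of v "u' \<bullet> v"] poly_mats_mult_vec[OF Q(1)]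
    by (auto simp: F.in_cycles_0 G.in_cycles_0)
  define C where "C = Q * P - 1\<^sub>m (b 0)"
  have C: "C \<in> poly_mats n (b 0) (b 0)"
    unfolding C_def by (intro poly_mats_minus poly_mats_mult[OF Q(1) P(1)] poly_mats_one)
  have "C *\<^sub>v v \<in> cycles n J b D u 0" if v: "v \<in> free_module n (b 0)" for v
  proof -
    note vc = free_module_carrier[OF v]
    have "C *\<^sub>v v = Q *\<^sub>v (P *\<^sub>v v) - v"
      unfolding C_def using Pc Qc vc by (subst minus_mult_distrib_mat_vec[where nr = "b 0" and nc = "b 0"]) auto
    then have "u \<bullet> (C *\<^sub>v v) = (u \<bullet> (Q *\<^sub>v (P *\<^sub>v v)) - u' \<bullet> (P *\<^sub>v v)) + (u' \<bullet> (P *\<^sub>v v) - u \<bullet> v)"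
      using Pc Qc vc uc by (simp add: scalar_prod_minus_distrib[where n = "b 0"])
    also have "\<dots> \<in> J"
      using ideal_polys_add[OF F.J Q(2)[OF poly_mats_mult_vec[OF P(1) v]] P(2)[OF v]] .
    finally show ?thesis using poly_mats_mult_vec[OF C v] by (simp add: F.in_cycles_0)
  qed
  then obtain h where h: "h \<in> poly_mats n (b (Suc 0)) (b 0)" "C = D 0 * h"
    using F.factor_through_D[OF C] by blast
  note hc = poly_mats_carrier[OF h(1)] and Dc = poly_mats_carrier[OF F.D[of 0]]
  have "map_mat const_coef C = 0\<^sub>m (b 0) (b 0)"
    unfolding h(2) const_coef.mat_hom_mult[OF Dc hc] F.const_coef_D using hc by simp
  moreover have "(C - D 0 * h) * D 0 = 0\<^sub>m (b 0) (b (Suc 0))"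
    unfolding h(2) using hc Dc by (simp add: minus_r_inv_mat[where nr = "b 0" and nc = "b 0"])
  ultimately show ?case
    using P(1) Q(1) h(1) PZ QZ unfolding C_def by blast
next
  case (Suc i)
  interpret F: min_free_resolution n J b D u by fact
  interpret G: min_free_resolution n J b' D' u' by fact
  from Suc obtain P Q h where P: "P \<in> poly_mats n (b' i) (b i)" and Q: "Q \<in> poly_mats n (b i) (b' i)"
    and h: "h \<in> poly_mats n (b (Suc i)) (b i)"
    and PZ: "\<And>v. v \<in> cycles n J b D u i \<Longrightarrow> P *\<^sub>v v \<in> cycles n J b' D' u' i"
    and QZ: "\<And>v. v \<in> cycles n J b' D' u' i \<Longrightarrow> Q *\<^sub>v v \<in> cycles n J b D u i"
    and hD: "(Q * P - 1\<^sub>m (b i) - D i * h) * D i = 0\<^sub>m (b i) (b (Suc i))"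
    by blast
  obtain P' where P': "P' \<in> poly_mats n (b' (Suc i)) (b (Suc i))" "P * D i = D' i * P'"
    "\<And>v. v \<in> cycles n J b D u (Suc i) \<Longrightarrow> P' *\<^sub>v v \<in> cycles n J b' D' u' (Suc i)"
    using comparison_step[OF F G P PZ] by blast
  obtain Q' where Q': "Q' \<in> poly_mats n (b (Suc i)) (b' (Suc i))" "Q * D' i = D i * Q'"
    "\<And>v. v \<in> cycles n J b' D' u' (Suc i) \<Longrightarrow> Q' *\<^sub>v v \<in> cycles n J b D u (Suc i)"
    using comparison_step[OF G F Q QZ] by blast
  note c = poly_mats_carrier[OF P] poly_mats_carrier[OF Q] poly_mats_carrier[OF h]
    poly_mats_carrier[OF P'(1)] poly_mats_carrier[OF Q'(1)]
    poly_mats_carrier[OF F.D[of i]] poly_mats_carrier[OF F.D[of "Suc i"]] poly_mats_carrier[OF G.D[of i]]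
  define C where "C = Q' * P' - 1\<^sub>m (b (Suc i))"
  define T where "T = C - h * D i"
  have C: "C \<in> poly_mats n (b (Suc i)) (b (Suc i))"
    unfolding C_def by (intro poly_mats_minus poly_mats_mult[OF Q'(1) P'(1)] poly_mats_one)
  have T: "T \<in> poly_mats n (b (Suc i)) (b (Suc i))"
    unfolding T_def by (intro poly_mats_minus C poly_mats_mult[OF h F.D])
  note Cc = poly_mats_carrier[OF C] and Tc = poly_mats_carrier[OF T]
  have "D i * T = D i * (Q' * P') - D i - D i * (h * D i)"
    unfolding T_def C_def
    using c mult_minus_distrib_mat[OF c(6) Cc[unfolded C_def] mult_carrier_mat[OF c(3) c(6)]]
      mult_minus_distrib_mat[OF c(6) mult_carrier_mat[OF c(5) c(4)] one_carrier_mat]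
    by simp
  also have "D i * (Q' * P') = (D i * Q') * P'" using c by simp
  also have "\<dots> = Q * (D' i * P')" unfolding Q'(2)[symmetric] using c by simp
  also have "\<dots> = Q * P * D i" unfolding P'(2)[symmetric] using c by simp
  also have "Q * P * D i - D i - D i * (h * D i) = (Q * P - 1\<^sub>m (b i) - D i * h) * D i"
    using c minus_mult_distrib_mat[OF minus_carrier_mat[OF one_carrier_mat] mult_carrier_mat[OF c(6) c(3)] c(6), of "Q * P"]
      minus_mult_distrib_mat[OF mult_carrier_mat[OF c(2) c(1)] one_carrier_mat c(6)]
    by simp
  finally have DT: "D i * T = 0\<^sub>m (b i) (b (Suc i))" using hD by simp
  have "T *\<^sub>v v \<in> cycles n J b D u (Suc i)" if v: "v \<in> free_module n (b (Suc i))" for v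
  proof -
    note vc = free_module_carrier[OF v]
    have "D i *\<^sub>v (T *\<^sub>v v) = (D i * T) *\<^sub>v v" using c Tc vc by simp
    also have "\<dots> = 0\<^sub>v (b i)" unfolding DT using vc by (intro eq_vecI) auto
    finally show ?thesis using poly_mats_mult_vec[OF T v] by (simp add: F.in_cycles_Suc)
  qed
  then obtain h' where h': "h' \<in> poly_mats n (b (Suc (Suc i))) (b (Suc i))" "T = D (Suc i) * h'"
    using F.factor_through_D[OF T] by blast
  note hc' = poly_mats_carrier[OF h'(1)]
  have CT: "C = T + h * D i"
    unfolding T_def using Cc c by (intro eq_matI) auto
  have "map_mat const_coef C = map_mat const_coef T + map_mat const_coef (h * D i)"
    unfolding CT using Tc c by (intro eq_matI) (auto simp: lookup_add)
  also have "\<dots> = 0\<^sub>m (b (Suc i)) (b (Suc i))"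
    unfolding h'(2) const_coef.mat_hom_mult[OF c(7) hc'] const_coef.mat_hom_mult[OF c(3) c(6)]
      F.const_coef_D using hc' c by simp
  finally have CC: "map_mat const_coef C = 0\<^sub>m (b (Suc i)) (b (Suc i))" .
  have "C - D (Suc i) * h' = h * D i"
    unfolding h'(2)[symmetric] CT using Tc c by (intro eq_matI) auto
  then have "(C - D (Suc i) * h') * D (Suc i) = h * (D i * D (Suc i))"
    using c by simp
  also have "\<dots> = 0\<^sub>m (b (Suc i)) (b (Suc (Suc i)))"
    unfolding F.D_D using c by simp
  finally show ?case
    using P'(1,3) Q'(1,3) h'(1) CC unfolding C_def by blast
qed

text \<open>
  Over the field, \<open>Q P\<close> becomes the identity, so the rank cannot drop from the
  first resolution to the second; the two resolutions may be exchanged.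
\<close>

theorem min_free_resolution_unique:
  fixes J :: "'k::field mpoly set"
  assumes "min_free_resolution n J b D u" and "min_free_resolution n J b' D' u'"
  shows "b i = b' i"
proof -
  have le: "b i \<le> b' i"
    if F: "min_free_resolution n J b D u" and G: "min_free_resolution n J b' D' u'" for b b' :: "nat \<Rightarrow> nat" and D u D' u'
  proof -
    obtain P Q :: "'k mpoly mat" where P: "P \<in> poly_mats n (b' i) (b i)" and Q: "Q \<in> poly_mats n (b i) (b' i)"
      and PQ: "map_mat const_coef (Q * P - 1\<^sub>m (b i)) = 0\<^sub>m (b i) (b i)"
      using comparison_homotopy[OF F G, of i] by blast
    note c = poly_mats_carrier[OF P] poly_mats_carrier[OF Q]
    have "map_mat const_coef Q * map_mat const_coef P = map_mat const_coef (Q * P)"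
      using const_coef.mat_hom_mult[OF c(2) c(1)] by simp
    also have "\<dots> = 1\<^sub>m (b i)"
    proof (rule eq_matI)
      fix j k assume "j < dim_row (1\<^sub>m (b i) :: 'k mat)" "k < dim_col (1\<^sub>m (b i) :: 'k mat)"
      then have jk: "j < b i" "k < b i" by auto
      have "map_mat const_coef (Q * P - 1\<^sub>m (b i)) $$ (j, k) = 0" using PQ jk by simp
      then show "map_mat const_coef (Q * P) $$ (j, k) = 1\<^sub>m (b i) $$ (j, k)"
        using jk c by (auto simp: lookup_minus lookup_one split: if_splits)
    qed (use c in auto)
    finally show ?thesis
      using c by (intro right_inverse_imp_dim_le[of "map_mat const_coef Q" _ _ "map_mat const_coef P"]) auto
  qed
  show ?thesis using le[OF assms] le[OF assms(2,1)] by simp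
qed

section \<open>Betti numbers from a based complex\<close>

lemma coset_zero_iff:
  fixes J :: "'k::field mpoly set"
  assumes J: "ideal J (poly_ring n)" and x: "x \<in> polys n"
  shows "J +>\<^bsub>poly_ring n\<^esub> x = \<zero>\<^bsub>poly_ring n Quot J\<^esub> \<longleftrightarrow> x \<in> J"
proof -
  have "J +>\<^bsub>poly_ring n\<^esub> 0 = J"
    using R.a_coset_add_zero[of J n] ideal_polysD[OF J] by auto
  moreover have "\<zero>\<^bsub>poly_ring n Quot J\<^esub> = J" by (simp add: FactRing_def)
  ultimately show ?thesis
    using R.quotient_eq_iff_same_a_r_cos[OF J x, of 0] by simp
qed

lemma carrier_quot: "carrier (poly_ring n Quot J) = (\<lambda>x. J +>\<^bsub>poly_ring n\<^esub> x) ` (polys n :: 'k::field mpoly set)"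
  by (auto simp: FactRing_def A_RCOSETS_def')

lemma free_module_scalar_prod:
  "u \<in> free_module n r \<Longrightarrow> v \<in> free_module n r \<Longrightarrow> u \<bullet> v \<in> polys n"
  by (auto simp: free_module_def scalar_prod_def intro!: polys_sum)

lemma graded_maps_poly_mats: "A \<in> graded_maps n r d s e \<Longrightarrow> A \<in> poly_mats n s r"
  by (simp add: graded_maps_def poly_mats_def)

lemma min_graded_imp_min_free_resolution:
  fixes J :: "'k::field mpoly set"
  assumes J: "ideal J (poly_ring n)" and res: "min_graded_free_resolution n J b d D u"
  shows "min_free_resolution n J b D u"
proof (rule min_free_resolution.intro)
  from res have D: "\<And>i. D i \<in> graded_maps n (b (Suc i)) (d (Suc i)) (b i) (d i)"
    and u: "u \<in> free_module n (b 0)"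
    and onto: "(\<lambda>v. J +>\<^bsub>poly_ring n\<^esub> (u \<bullet> v)) ` free_module n (b 0) = carrier (poly_ring n Quot J)"
    and ex0: "{v \<in> free_module n (b 0). J +>\<^bsub>poly_ring n\<^esub> (u \<bullet> v) = \<zero>\<^bsub>poly_ring n Quot J\<^esub>} =
      (\<lambda>w. D 0 *\<^sub>v w) ` free_module n (b 1)"
    and exS: "\<And>i. {v \<in> free_module n (b (Suc i)). D i *\<^sub>v v = 0\<^sub>v (b i)} =
      (\<lambda>w. D (Suc i) *\<^sub>v w) ` free_module n (b (Suc (Suc i)))"
    and min: "\<And>i j k. j < b i \<Longrightarrow> k < b (Suc i) \<Longrightarrow> D i $$ (j, k) \<in> irrelevant_ideal n"
    unfolding min_graded_free_resolution_def by auto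
  show "ideal J (poly_ring n)" by (rule J)
  show "D i \<in> poly_mats n (b i) (b (Suc i))" for i using graded_maps_poly_mats[OF D] .
  show "u \<in> free_module n (b 0)" by (rule u)
  show "\<exists>v\<in>free_module n (b 0). u \<bullet> v - x \<in> J" if x: "x \<in> polys n" for x
  proof -
    have "J +>\<^bsub>poly_ring n\<^esub> x \<in> (\<lambda>v. J +>\<^bsub>poly_ring n\<^esub> (u \<bullet> v)) ` free_module n (b 0)"
      unfolding onto carrier_quot using x by blast
    then obtain v where v: "v \<in> free_module n (b 0)" "J +>\<^bsub>poly_ring n\<^esub> (u \<bullet> v) = J +>\<^bsub>poly_ring n\<^esub> x"
      by auto
    then show ?thesis
      using R.quotient_eq_iff_same_a_r_cos[OF J free_module_scalar_prod[OF u v(1)] x] x by auto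
  qed
  show "cycles n J b D u i = (\<lambda>w. D i *\<^sub>v w) ` free_module n (b (Suc i))" for i
  proof (cases i)
    case 0
    have "cycles n J b D u 0 = {v \<in> free_module n (b 0). J +>\<^bsub>poly_ring n\<^esub> (u \<bullet> v) = \<zero>\<^bsub>poly_ring n Quot J\<^esub>}"
      using coset_zero_iff[OF J free_module_scalar_prod[OF u]] by (auto simp: cycles_def)
    then show ?thesis using ex0 0 by simp
  next
    case (Suc j)
    then show ?thesis using exS[of j] by (simp add: cycles_def)
  qed
  show "const_coef (D i $$ (j, k)) = 0" if "j < b i" "k < b (Suc i)" for i j k
    using min[OF that] by (simp add: irrelevant_ideal_eq)
qed

lemma betti_eqI:
  assumes J: "ideal J (poly_ring n)" and res: "min_graded_free_resolution n J b d D u"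
  shows "betti n J i = b i"
  unfolding betti_def
proof (rule the_equality)
  show "\<exists>b' d D u. min_graded_free_resolution n J b' d D u \<and> b' i = b i" using res by blast
next
  fix r assume "\<exists>b' d D u. min_graded_free_resolution n J b' d D u \<and> b' i = r"
  then show "r = b i"
    using min_free_resolution_unique min_graded_imp_min_free_resolution[OF J] res by metis
qed

text \<open>
  A resolution is often given by matrices whose rows and columns are indexed by the cells of
  a complex. Enumerating the cells of each dimension turns such data into matrices indexed
  by numbers. Exactness is required only as the inclusion of cycles in boundaries, for
  chains extended by 0 outside the cells of their dimension.
\<close>

lemma betti_eq_card_cells:
  fixes X :: "nat \<Rightarrow> 'a set" and M :: "'a \<Rightarrow> 'a \<Rightarrow> 'k::field mpoly"
  assumes fin: "\<And>i. finite (X i)" and X0: "X 0 = {c0}" and deg0: "deg c0 = 0"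
    and M: "\<And>i c c'. c \<in> X (Suc i) \<Longrightarrow> c' \<in> X i \<Longrightarrow>
      M c c' \<in> polys n \<and> homogeneous (deg c - deg c') (M c c') \<and> const_coef (M c c') = 0"
    and J: "J = Idl\<^bsub>poly_ring n\<^esub> ((\<lambda>c. M c c0) ` X 1)"
    and complex: "\<And>i c c''. c \<in> X (Suc (Suc i)) \<Longrightarrow> c'' \<in> X i \<Longrightarrow>
      (\<Sum>c'\<in>X (Suc i). M c c' * M c' c'') = 0"
    and exact: "\<And>i v. (\<And>c. v c \<in> polys n) \<Longrightarrow> (\<And>c. c \<notin> X (Suc i) \<Longrightarrow> v c = 0) \<Longrightarrow>
      (\<And>c'. c' \<in> X i \<Longrightarrow> (\<Sum>c\<in>X (Suc i). M c c' * v c) = 0) \<Longrightarrow>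
      \<exists>w. (\<forall>c. w c \<in> polys n) \<and> (\<forall>c\<in>X (Suc i). v c = (\<Sum>c''\<in>X (Suc (Suc i)). M c'' c * w c''))"
  shows "betti n J i = card (X i)"
proof -
  define b where "b i = card (X i)" for i
  have "\<forall>i. \<exists>e. bij_betw e {..<b i} (X i)"
    using ex_bij_betw_nat_finite[OF fin] by (simp add: b_def atLeast0LessThan)
  then obtain e where e: "\<And>i. bij_betw (e i) {..<b i} (X i)" by metis
  have e_in: "e i k \<in> X i" if "k < b i" for i k
    using e[of i] that by (auto simp: bij_betw_def)
  define inv_e where "inv_e i = the_inv_into {..<b i} (e i)" for i
  have inv_e: "inv_e i (e i k) = k" if "k < b i" for i k
    using e[of i] that by (auto simp: inv_e_def bij_betw_def the_inv_into_f_f)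
  have e_inv: "inv_e i c < b i \<and> e i (inv_e i c) = c" if "c \<in> X i" for i c
  proof -
    have "c \<in> e i ` {..<b i}" using e[of i] that by (simp add: bij_betw_def)
    then show ?thesis using inv_e by auto
  qed
  define fn where "fn i v c = (if c \<in> X i then v $ inv_e i c else 0)" for i c and v :: "'k mpoly vec"
  have fn_polys: "fn i v c \<in> polys n" if "v \<in> free_module n (b i)" for i v c
    using that e_inv by (auto simp: fn_def free_module_def)
  have fn_e: "fn i v (e i k) = v $ k" if "k < b i" for i v k
    using that e_in inv_e by (simp add: fn_def)
  define vc where "vc i f = vec (b i) (\<lambda>k. f (e i k))" for i and f :: "'a \<Rightarrow> 'k mpoly"
  have vc_free: "vc i f \<in> free_module n (b i)" if "\<And>c. f c \<in> polys n" for i f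
    using that by (auto simp: vc_def free_module_def)
  have fn_vc: "fn i (vc i f) c = f c" if "c \<in> X i" for i f c
    using e_inv[OF that] that by (simp add: fn_def vc_def)
  define D where "D i = mat (b i) (b (Suc i)) (\<lambda>(j, k). M (e (Suc i) k) (e i j))" for i
  define u where "u = vec 1 (\<lambda>_. 1 :: 'k mpoly)"
  have D_vec: "(D i *\<^sub>v v) $ j = (\<Sum>c\<in>X (Suc i). M c (e i j) * fn (Suc i) v c)"
    if "v \<in> free_module n (b (Suc i))" "j < b i" for i v j
  proof -
    have "(\<Sum>c\<in>X (Suc i). M c (e i j) * fn (Suc i) v c)
        = (\<Sum>k<b (Suc i). M (e (Suc i) k) (e i j) * fn (Suc i) v (e (Suc i) k))"
      using sum.reindex_bij_betw[OF e[of "Suc i"], of "\<lambda>c. M c (e i j) * fn (Suc i) v c"] by simp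
    also have "\<dots> = (D i *\<^sub>v v) $ j"
      using that by (auto simp: D_def scalar_prod_def atLeast0LessThan fn_e free_module_def intro!: sum.cong)
    finally show ?thesis by simp
  qed
  have b0: "b 0 = 1" by (simp add: b_def X0)
  have e0: "e 0 0 = c0" using e_in[of 0 0] X0 b0 by simp
  have Mc0: "M c c0 \<in> polys n" if "c \<in> X 1" for c
    using M[of c 0 c0] that X0 by simp
  have idJ: "ideal J (poly_ring n)"
    unfolding J by (rule R.genideal_ideal) (use Mc0 in auto)
  have u_free: "u \<in> free_module n (b 0)" by (auto simp: u_def free_module_def b0)
  have uv: "u \<bullet> v = v $ 0" if "v \<in> free_module n (b 0)" for v
  proof -
    have "dim_vec v = 1" using that by (auto simp: free_module_def b0)
    then show ?thesis by (simp add: u_def scalar_prod_def)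
  qed
  note M_e = M[OF e_in e_in]
  have D_mats: "D i \<in> poly_mats n (b i) (b (Suc i))" for i
    using M_e by (auto simp: poly_mats_def D_def)
  have "min_graded_free_resolution n J b (\<lambda>i k. deg (e i k)) D u"
    unfolding min_graded_free_resolution_def
  proof (intro conjI allI impI)
    show "D i \<in> graded_maps n (b (Suc i)) (\<lambda>k. deg (e (Suc i) k)) (b i) (\<lambda>k. deg (e i k))" for i
      using M_e by (auto simp: graded_maps_def D_def)
    show "u \<in> free_module n (b 0)" by (rule u_free)
    show "homogeneous (deg (e 0 k)) (u $ k)" if "k < b 0" for k
      using that by (simp add: b0 e0 deg0 u_def homogeneous_def)
    show "(\<lambda>v. J +>\<^bsub>poly_ring n\<^esub> (u \<bullet> v)) ` free_module n (b 0) = carrier (poly_ring n Quot J)"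
      unfolding carrier_quot
    proof (intro equalityI subsetI)
      fix y assume "y \<in> (\<lambda>x. J +>\<^bsub>poly_ring n\<^esub> x) ` polys n"
      then obtain x where x: "x \<in> polys n" "y = J +>\<^bsub>poly_ring n\<^esub> x" by blast
      have v: "vec 1 (\<lambda>_. x) \<in> free_module n (b 0)" using x by (simp add: free_module_def b0)
      have "u \<bullet> vec 1 (\<lambda>_. x) = x" using uv[OF v] by simp
      with v x(2) show "y \<in> (\<lambda>v. J +>\<^bsub>poly_ring n\<^esub> (u \<bullet> v)) ` free_module n (b 0)"
        by (metis (no_types, lifting) image_eqI)
    qed (auto intro!: imageI free_module_scalar_prod[OF u_free])
    show "{v \<in> free_module n (b 0). J +>\<^bsub>poly_ring n\<^esub> (u \<bullet> v) = \<zero>\<^bsub>poly_ring n Quot J\<^esub>} =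
      (\<lambda>w. D 0 *\<^sub>v w) ` free_module n (b 1)" (is "?L = ?R")
    proof -
      have L: "?L = {v \<in> free_module n (b 0). v $ 0 \<in> J}"
        using coset_zero_iff[OF idJ free_module_scalar_prod[OF u_free]] uv
        by (intro Collect_cong conj_cong refl) simp
      have J': "J = {\<Sum>c\<in>X 1. M c c0 * w c | w. \<forall>c. w c \<in> polys n}"
        unfolding J by (rule Idl_finite_eq_combinations) (use fin Mc0 in auto)
      show ?thesis unfolding L
      proof (intro equalityI subsetI)
        fix v assume v: "v \<in> {v \<in> free_module n (b 0). v $ 0 \<in> J}"
        then obtain w where w: "v $ 0 = (\<Sum>c\<in>X 1. M c c0 * w c)" "\<forall>c. w c \<in> polys n"
          unfolding J' by auto
        have "D 0 *\<^sub>v vc 1 w = v"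
        proof (rule eq_vecI)
          fix j assume "j < dim_vec v"
          then have "j = 0" using v by (auto simp: free_module_def b0)
          then show "(D 0 *\<^sub>v vc 1 w) $ j = v $ j"
            using D_vec[of "vc 1 w" 0 0] vc_free[of w 1] w by (simp add: b0 e0 fn_vc)
        qed (use v in \<open>auto simp: D_def free_module_def\<close>)
        then show "v \<in> ?R" using vc_free[of w 1] w(2) by (metis image_eqI)
      next
        fix v assume "v \<in> ?R"
        then obtain w where w: "v = D 0 *\<^sub>v w" "w \<in> free_module n (b 1)" by blast
        then have "v $ 0 = (\<Sum>c\<in>X 1. M c c0 * fn 1 w c)"
          using D_vec[of w 0 0] by (simp add: b0 e0)
        then have "v $ 0 \<in> J"
          using fn_polys[of w 1] w(2) unfolding J' by blast
        moreover have "v \<in> free_module n (b 0)"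
          unfolding w(1) by (rule poly_mats_mult_vec[OF D_mats]) (use w(2) in simp)
        ultimately show "v \<in> {v \<in> free_module n (b 0). v $ 0 \<in> J}" by blast
      qed
    qed
    show "{v \<in> free_module n (b (Suc i)). D i *\<^sub>v v = 0\<^sub>v (b i)} =
      (\<lambda>w. D (Suc i) *\<^sub>v w) ` free_module n (b (Suc (Suc i)))" (is "?L = ?R") for i
    proof (intro equalityI subsetI)
      fix v assume "v \<in> ?L"
      then have v: "v \<in> free_module n (b (Suc i))" and Dv: "D i *\<^sub>v v = 0\<^sub>v (b i)" by auto
      have "(\<Sum>c\<in>X (Suc i). M c c' * fn (Suc i) v c) = 0" if "c' \<in> X i" for c'
        using D_vec[OF v, of "inv_e i c'"] e_inv[OF that] Dv by simp
      from exact[of "fn (Suc i) v" i, OF fn_polys[OF v] _ this] obtain w where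
        w: "\<forall>c. w c \<in> polys n" "\<forall>c\<in>X (Suc i). fn (Suc i) v c = (\<Sum>c''\<in>X (Suc (Suc i)). M c'' c * w c'')"
        by (auto simp: fn_def)
      have wf: "vc (Suc (Suc i)) w \<in> free_module n (b (Suc (Suc i)))" using vc_free w(1) by simp
      have "v = D (Suc i) *\<^sub>v vc (Suc (Suc i)) w"
      proof (rule eq_vecI)
        fix j assume "j < dim_vec (D (Suc i) *\<^sub>v vc (Suc (Suc i)) w)"
        then have j: "j < b (Suc i)" by (simp add: D_def)
        have "v $ j = fn (Suc i) v (e (Suc i) j)" using fn_e[OF j] by simp
        also have "\<dots> = (\<Sum>c''\<in>X (Suc (Suc i)). M c'' (e (Suc i) j) * w c'')"
          using w(2) e_in[OF j] by blast
        also have "\<dots> = (D (Suc i) *\<^sub>v vc (Suc (Suc i)) w) $ j"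
          using D_vec[OF wf j] by (simp add: fn_vc)
        finally show "v $ j = (D (Suc i) *\<^sub>v vc (Suc (Suc i)) w) $ j" .
      qed (use v in \<open>auto simp: D_def free_module_def\<close>)
      then show "v \<in> ?R" using wf by blast
    next
      fix v assume "v \<in> ?R"
      then obtain w where w: "v = D (Suc i) *\<^sub>v w" "w \<in> free_module n (b (Suc (Suc i)))" by blast
      have v: "v \<in> free_module n (b (Suc i))" unfolding w(1) by (rule poly_mats_mult_vec[OF D_mats w(2)])
      have "D i *\<^sub>v v = 0\<^sub>v (b i)"
      proof (rule eq_vecI)
        fix j assume "j < dim_vec (0\<^sub>v (b i) :: 'k mpoly vec)"
        then have j: "j < b i" by simp
        have "(D i *\<^sub>v v) $ j = (\<Sum>c\<in>X (Suc i). M c (e i j) * fn (Suc i) v c)"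
          by (rule D_vec[OF v j])
        also have "\<dots> = (\<Sum>c\<in>X (Suc i). M c (e i j) * (\<Sum>c2\<in>X (Suc (Suc i)). M c2 c * fn (Suc (Suc i)) w c2))"
        proof (intro sum.cong refl arg_cong2[of _ _ _ _ "(*)"])
          fix c assume "c \<in> X (Suc i)"
          then show "fn (Suc i) v c = (\<Sum>c2\<in>X (Suc (Suc i)). M c2 c * fn (Suc (Suc i)) w c2)"
            using D_vec[OF w(2), of "inv_e (Suc i) c"] e_inv by (simp add: fn_def w(1))
        qed
        also have "\<dots> = (\<Sum>c2\<in>X (Suc (Suc i)). (\<Sum>c\<in>X (Suc i). M c2 c * M c (e i j)) * fn (Suc (Suc i)) w c2)"
          unfolding sum_distrib_left sum_distrib_right
          by (subst sum.swap) (simp add: mult_ac)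
        also have "\<dots> = 0" using complex e_in[OF j] by simp
        finally show "(D i *\<^sub>v v) $ j = 0\<^sub>v (b i) $ j" using j by simp
      qed (simp add: D_def)
      with v show "v \<in> ?L" by blast
    qed
    show "D i $$ (j, k) \<in> irrelevant_ideal n" if "j < b i" "k < b (Suc i)" for i j k
      using M[OF e_in[OF that(2)] e_in[OF that(1)]] that by (simp add: D_def irrelevant_ideal_eq)
  qed
  from betti_eqI[OF idJ this] show ?thesis by (simp add: b_def)
qed

section \<open>Primes generated by variables\<close>

text \<open>
  The ideal \<open>(x\<^sub>1, \<dots>, x\<^sub>r)\<close> when \<open>r \<le> n\<close>,
  described by its monomials.
\<close>

definition var_prime :: "nat \<Rightarrow> nat \<Rightarrow> 'k::field mpoly set" where
  "var_prime n r = {p \<in> polys n. \<forall>a\<in>mons p. set_mset a \<inter> {1..r} \<noteq> {}}"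

lemma ideal_var_prime: "ideal (var_prime n r :: 'k::field mpoly set) (poly_ring n)"
proof (rule poly_idealI)
  fix p q :: "'k mpoly" assume "p \<in> var_prime n r" "q \<in> var_prime n r"
  then show "p + q \<in> var_prime n r" using keys_add[of p q] unfolding var_prime_def by blast
next
  fix p q :: "'k mpoly" assume p: "p \<in> var_prime n r" and q: "q \<in> polys n"
  have "set_mset c \<inter> {1..r} \<noteq> {}" if c: "c \<in> mons (q * p)" for c
  proof -
    obtain a b where "c = a + b" "b \<in> mons p" using c keys_mult[of q p] by blast
    then show ?thesis using p by (auto simp: var_prime_def)
  qed
  then show "q * p \<in> var_prime n r" using p q by (simp add: var_prime_def)
qed (auto simp: var_prime_def)

text \<open>
  Split \<open>p\<close> and \<open>q\<close> into the monomials inside and outside the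
  ideal. If \<open>p q\<close> is in the ideal, so is the product of the outer parts; but
  none of its monomials involves one of the variables, so it vanishes, and with it one of
  the outer parts.
\<close>

lemma primeideal_var_prime: "primeideal (var_prime n r :: 'k::field mpoly set) (poly_ring n)"
proof (rule primeidealI[OF ideal_var_prime cring_poly_ring])
  have "1 \<notin> (var_prime n r :: 'k mpoly set)" by (simp add: var_prime_def)
  then show "polys n \<noteq> (var_prime n r :: 'k mpoly set)" by blast
next
  fix p q :: "'k mpoly" assume p: "p \<in> polys n" and q: "q \<in> polys n"
    and "p \<otimes>\<^bsub>poly_ring n\<^esub> q \<in> var_prime n r"
  then have pq: "p * q \<in> var_prime n r" by simp
  have I: "ideal (var_prime n r :: 'k mpoly set) (poly_ring n)" by (rule ideal_var_prime)
  let ?S = "{a. set_mset a \<inter> {1..r} \<noteq> {}}"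
  obtain p' p'' where p': "p = p' + p''" "mons p' = mons p \<inter> ?S" "mons p'' = mons p - ?S"
    by (rule split_mons)
  obtain q' q'' where q': "q = q' + q''" "mons q' = mons q \<inter> ?S" "mons q'' = mons q - ?S"
    by (rule split_mons)
  have in_polys: "p' \<in> polys n" "p'' \<in> polys n" "q' \<in> polys n" "q'' \<in> polys n"
    using p q p' q' by (auto simp: mem_polys)
  have p'q': "p' \<in> var_prime n r" "q' \<in> var_prime n r"
    using in_polys p' q' by (auto simp: var_prime_def)
  have "p'' * q'' = p * q - (q * p' + p'' * q')" unfolding p' q' by (simp add: algebra_simps)
  also have "\<dots> \<in> var_prime n r"
    by (rule ideal_polys_diff[OF I pq ideal_polys_add[OF I]])
      (rule ideal_polys_mult[OF I]; use p'q' in_polys q in simp)+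
  finally have mem: "p'' * q'' \<in> var_prime n r" .
  have "p'' * q'' = 0"
  proof (rule ccontr)
    assume "p'' * q'' \<noteq> 0"
    then have "mons (p'' * q'') \<noteq> {}" by simp
    then obtain c where c: "c \<in> mons (p'' * q'')" by blast
    then obtain a b where "c = a + b" "a \<in> mons p''" "b \<in> mons q''" using keys_mult[of p'' q''] by blast
    then have "set_mset c \<inter> {1..r} = {}" using p'(3) q'(3) by auto
    with c mem show False by (auto simp: var_prime_def)
  qed
  then have "p'' = 0 \<or> q'' = 0" by simp
  then show "p \<in> var_prime n r \<or> q \<in> var_prime n r"
    using p' q' p'q' by auto
qed

lemma var_in_var_prime: "(var i :: 'k::field mpoly) \<in> var_prime n r \<longleftrightarrow> 1 \<le> i \<and> i \<le> n \<and> i \<le> r"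
  by (auto simp: var_prime_def)

lemma var_prime_strict_mono:
  assumes "r < s" "s \<le> n"
  shows "(var_prime n r :: 'k::field mpoly set) \<subset> var_prime n s"
proof
  show "(var_prime n r :: 'k mpoly set) \<subseteq> var_prime n s"
    using assms by (fastforce simp: var_prime_def)
  have "(var s :: 'k mpoly) \<in> var_prime n s - var_prime n r" using assms by (simp add: var_in_var_prime)
  then show "(var_prime n r :: 'k mpoly set) \<noteq> var_prime n s" by blast
qed

lemma var_prime_subset_ideal:
  fixes Q :: "'k::field mpoly set"
  assumes Q: "ideal Q (poly_ring n)" and var: "\<And>i. 1 \<le> i \<Longrightarrow> i \<le> r \<Longrightarrow> var i \<in> Q"
  shows "var_prime n r \<subseteq> Q"
proof
  fix p :: "'k mpoly" assume p: "p \<in> var_prime n r"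
  show "p \<in> Q"
  proof (rule ideal_contains_monomial_combinations[OF Q])
    fix a assume a: "a \<in> mons p"
    then have "set_mset a \<inter> {1..r} \<noteq> {}" using p by (auto simp: var_prime_def)
    then obtain i where i: "i \<in># a" "1 \<le> i" "i \<le> r" by auto
    have "set_mset (a - {#i#}) \<subseteq> {1..n}" using p a by (auto simp: var_prime_def mem_polys dest!: in_diffD)
    then have "monomial (a - {#i#}) * var i \<in> Q"
      using var[OF i(2,3)] by (intro ideal_polys_mult[OF Q]) auto
    then show "monomial a \<in> Q" using i(1) by (simp flip: monomial_add)
  qed
qed

section \<open>Krull dimension and height\<close>

text \<open>
  The reason why chains of primes are short: if \<open>f i\<close> lies in
  \<open>Q (i + 1)\<close> but not in \<open>Q i\<close>, the products of powers of
  \<open>f j, f (j + 1), \<dots>\<close> are linearly independent modulo \<open>Q j\<close>.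
  Descend from the top of the chain, where only the empty product is left. In a relation
  modulo \<open>Q j\<close> the least power of \<open>f j\<close> cancels, since
  \<open>Q j\<close> is prime; modulo \<open>Q (j + 1)\<close> only the terms with that
  least power survive, and they have zero coefficients by the independence modulo
  \<open>Q (j + 1)\<close>. A tuple of exponents is a list; \<open>d\<close> bounds the
  exponents and keeps the family finite.
\<close>

lemma prime_chain_independent:
  fixes Q :: "nat \<Rightarrow> 'k::field mpoly set"
  assumes prime: "\<And>i. i \<le> k \<Longrightarrow> primeideal (Q i) (poly_ring n)"
    and mono: "\<And>i. i < k \<Longrightarrow> Q i \<subseteq> Q (Suc i)"
    and f: "\<And>i. i < k \<Longrightarrow> f i \<in> Q (Suc i) - Q i"
    and j: "j \<le> k"
    and E: "E = {es. set es \<subseteq> {..<d} \<and> length es = k - j}"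
    and g: "\<And>es. g es = (\<Prod>i<length es. f (j + i) ^ (es ! i))"
    and mem: "(\<Sum>es\<in>E. Poly_Mapping.single 0 (c es) * g es) \<in> Q j"
    and es: "es \<in> E"
  shows "c es = 0"
  using j E g mem es
proof (induction "k - j" arbitrary: j E g c es)
  case 0
  then have [simp]: "j = k" by simp
  have E: "E = {[]}" using 0 by auto
  from 0(6)[unfolded E] have "es = []" by simp
  moreover from 0(5)[unfolded E] have "Poly_Mapping.single 0 (c []) \<in> Q k"
    by (simp add: 0(4))
  moreover have "Poly_Mapping.single 0 (c []) \<notin> Q k" if "c [] \<noteq> 0"
  proof
    interpret Q: primeideal "Q k" "poly_ring n" by (rule prime) simp
    assume "Poly_Mapping.single 0 (c []) \<in> Q k"
    then have "Poly_Mapping.single 0 (inverse (c [])) * Poly_Mapping.single 0 (c []) \<in> Q k"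
      by (rule ideal_polys_mult[OF Q.is_ideal]) simp
    then have "1 \<in> Q k" using that by (simp add: mult_single)
    then show False using Q.one_imp_carrier Q.I_notcarr by simp
  qed
  ultimately show ?case by blast
next
  case (Suc r)
  then have jk: "j < k" by simp
  interpret Q: primeideal "Q j" "poly_ring n" by (rule prime) (use jk in simp)
  define E' where "E' = {es. set es \<subseteq> {..<d} \<and> length es = k - Suc j}"
  define g' where "g' es = (\<Prod>i<length es. f (Suc j + i) ^ (es ! i))" for es
  have finE': "finite E'" unfolding E'_def by (rule finite_lists_length_eq) simp
  have f_polys: "f i \<in> polys n" if "i < k" for i
    using f[OF that] ideal_polysD[OF primeideal.axioms(1)[OF prime[of "Suc i"]]] that by simp
  have gCons: "g (e # es) = f j ^ e * g' es" for e es
    unfolding Suc.prems(3) g'_def length_Cons prod.lessThan_Suc_shift by simp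
  have g'_polys: "g' es \<in> polys n" if "es \<in> E'" for es
  proof -
    have "(\<Prod>i\<in>I. f (Suc j + i) ^ (es ! i)) \<in> polys n" if "I \<subseteq> {..<length es}" for I
      using finite_subset[OF that finite_lessThan] that
    proof (induction I rule: finite_induct)
      case (insert x F)
      have "Suc j + x < k" using insert.prems \<open>es \<in> E'\<close> by (auto simp: E'_def)
      then have "f (Suc j + x) ^ (es ! x) \<in> polys n" by (rule polys_power[OF f_polys])
      then show ?case using insert by simp
    qed simp
    then show ?thesis unfolding g'_def by blast
  qed
  have E_eq: "E = (\<lambda>(e, es). e # es) ` ({..<d} \<times> E')"
  proof (intro Set.set_eqI iffI)
    fix x assume x: "x \<in> E"
    then obtain e es where "x = e # es" using Suc jk by (cases x) auto
    then show "x \<in> (\<lambda>(e, es). e # es) ` ({..<d} \<times> E')" using x Suc.prems(2) by (auto simp: E'_def)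
  qed (use Suc.prems(2) jk in \<open>auto simp: E'_def\<close>)
  define s where "s e = (\<Sum>es\<in>E'. Poly_Mapping.single 0 (c (e # es)) * g' es)" for e
  have s_polys: "s e \<in> polys n" for e
    unfolding s_def using g'_polys by auto
  have total: "(\<Sum>es\<in>E. Poly_Mapping.single 0 (c es) * g es) = (\<Sum>e<d. f j ^ e * s e)"
  proof -
    have "(\<Sum>es\<in>E. Poly_Mapping.single 0 (c es) * g es)
        = (\<Sum>(e, es)\<in>{..<d} \<times> E'. Poly_Mapping.single 0 (c (e # es)) * g (e # es))"
      unfolding E_eq by (subst sum.reindex) (auto simp: inj_on_def split_def)
    also have "\<dots> = (\<Sum>e<d. \<Sum>es\<in>E'. Poly_Mapping.single 0 (c (e # es)) * g (e # es))"
      by (rule sum.cartesian_product[symmetric])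
    finally show ?thesis by (simp add: gCons s_def sum_distrib_left mult_ac)
  qed
  have "\<forall>es\<in>E'. c (e # es) = 0" if "e < d" for e
    using that
  proof (induction e rule: less_induct)
    case (less e)
    have s0: "s e' = 0" if "e' < e" for e'
      unfolding s_def using less that by simp
    have "(\<Sum>e'<d. f j ^ e' * s e') = (\<Sum>e'\<in>{e..<d}. f j ^ e' * s e')"
      by (rule sum.mono_neutral_right) (auto simp: s0)
    also have "\<dots> = f j ^ e * (\<Sum>e'\<in>{e..<d}. f j ^ (e' - e) * s e')"
      by (simp add: sum_distrib_left power_add[symmetric] flip: mult.assoc)
    finally have "f j ^ e * (\<Sum>e'\<in>{e..<d}. f j ^ (e' - e) * s e') \<in> Q j"
      using Suc.prems(4) total by simp
    moreover have "f j ^ e \<notin> Q j"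
    proof (induction e)
      case 0
      then show ?case using Q.one_imp_carrier Q.I_notcarr by auto
    next
      case (Suc e)
      then show ?case
        using Q.I_prime[of "f j" "f j ^ e"] f[OF jk] f_polys[OF jk] polys_power[OF f_polys[OF jk]] by auto
    qed
    moreover have rest: "(\<Sum>e'\<in>A. f j ^ (e' - e) * s e') \<in> polys n" for A
      using s_polys polys_power[OF f_polys[OF jk]] by auto
    ultimately have "(\<Sum>e'\<in>{e..<d}. f j ^ (e' - e) * s e') \<in> Q j"
      using Q.I_prime[of "f j ^ e" "\<Sum>e'\<in>{e..<d}. f j ^ (e' - e) * s e'"]
        polys_power[OF f_polys[OF jk], of e] by auto
    then have total': "(\<Sum>e'\<in>{e..<d}. f j ^ (e' - e) * s e') \<in> Q (Suc j)"
      using mono[OF jk] by blast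
    note Q' = primeideal.axioms(1)[OF prime[of "Suc j"]]
    have "(\<Sum>e'\<in>{Suc e..<d}. f j ^ (e' - e) * s e') \<in> Q (Suc j)"
    proof (intro ideal_polys_sum)
      fix e' assume "e' \<in> {Suc e..<d}"
      then have "f j ^ (e' - e) = f j ^ (e' - Suc e) * f j"
        by (metis Suc_diff_Suc Suc_le_lessD atLeastLessThan_iff power_Suc2)
      then have "f j ^ (e' - e) * s e' = (f j ^ (e' - Suc e) * s e') * f j" by (simp add: mult_ac)
      also have "\<dots> \<in> Q (Suc j)"
        using f[OF jk] s_polys polys_power[OF f_polys[OF jk]] jk
        by (intro ideal_polys_mult[OF Q']) auto
      finally show "f j ^ (e' - e) * s e' \<in> Q (Suc j)" .
    qed (rule Q', use jk in simp)
    from ideal_polys_diff[OF Q' total' this] jk less.prems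
    have se: "s e \<in> Q (Suc j)" by (simp add: sum.atLeast_Suc_lessThan)
    show ?case
    proof
      fix es assume "es \<in> E'"
      then show "c (e # es) = 0"
        using Suc(1)[of "Suc j" E' g' "\<lambda>es. c (e # es)" es] Suc(2) jk se
        by (simp add: E'_def g'_def s_def)
    qed
  qed
  moreover obtain e es' where "es = e # es'" "e < d" "es' \<in> E'"
    using Suc.prems(5) unfolding E_eq by auto
  ultimately show ?case by simp
qed

definition total_degree_le :: "nat \<Rightarrow> 'k::field mpoly \<Rightarrow> bool" where
  "total_degree_le N p \<longleftrightarrow> (\<forall>a\<in>mons p. size a \<le> N)"

lemma total_degree_le_mult:
  assumes "total_degree_le N p" "total_degree_le M q"
  shows "total_degree_le (N + M) (p * q)"
  unfolding total_degree_le_def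
proof
  fix c assume "c \<in> mons (p * q)"
  then obtain a b where "c = a + b" "a \<in> mons p" "b \<in> mons q" using keys_mult[of p q] by blast
  then show "size c \<le> N + M" using assms by (auto simp: total_degree_le_def intro: add_mono)
qed

lemma total_degree_le_power: "total_degree_le N p \<Longrightarrow> total_degree_le (e * N) (p ^ e)"
proof (induction e)
  case (Suc e)
  then show ?case using total_degree_le_mult[of N p "e * N" "p ^ e"] by simp
qed (simp add: total_degree_le_def)

lemma total_degree_le_prod:
  "(\<And>i. i < k \<Longrightarrow> total_degree_le N (p i)) \<Longrightarrow> total_degree_le (k * N) (\<Prod>i<k. p i)"
proof (induction k)
  case (Suc k)
  then show ?case using total_degree_le_mult[of "k * N" "\<Prod>i<k. p i" N "p k"] by (simp add: add.commute)
qed (simp add: total_degree_le_def)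

lemma monomials_degree_le:
  fixes n N :: nat
  defines "Y \<equiv> {a. set_mset a \<subseteq> {1..n} \<and> size a \<le> N}"
  shows "finite Y" and "card Y \<le> (N + 1) ^ n"
proof -
  let ?h = "\<lambda>a. restrict (count a) {1..n}"
  have inj: "inj_on ?h Y"
  proof (rule inj_onI)
    fix a b assume ab: "a \<in> Y" "b \<in> Y" "?h a = ?h b"
    show "a = b"
    proof (rule multiset_eqI)
      fix i
      show "count a i = count b i"
      proof (cases "i \<in> {1..n}")
        case True
        then show ?thesis using fun_cong[OF ab(3), of i] by simp
      next
        case False
        then have "i \<notin># a" "i \<notin># b" using ab(1,2) unfolding Y_def by blast+
        then show ?thesis by (simp add: not_in_iff)
      qed
    qed
  qed
  have sub: "?h ` Y \<subseteq> {1..n} \<rightarrow>\<^sub>E {..N}"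
  proof (rule image_subsetI)
    fix a assume "a \<in> Y"
    then have "count a i \<le> N" for i
      using count_le_size[of a i] by (simp add: Y_def)
    then show "?h a \<in> {1..n} \<rightarrow>\<^sub>E {..N}" by auto
  qed
  have fin: "finite ({1..n} \<rightarrow>\<^sub>E {..N})" by (intro finite_PiE) auto
  show "finite Y" using inj sub fin inj_on_finite by blast
  have "card Y \<le> card ({1..n} \<rightarrow>\<^sub>E {..N})" by (rule card_inj_on_le[OF inj sub fin])
  then show "card Y \<le> (N + 1) ^ n" by (simp add: card_funcsetE)
qed

text \<open>
  A chain of length \<open>k\<close> provides \<open>d\<^sup>k\<close> linearly independent
  products with exponents below \<open>d\<close>. Their degrees grow linearly with
  \<open>d\<close>, so they lie in a space of dimension \<open>O(d\<^sup>n)\<close>, which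
  is impossible for large \<open>d\<close> unless \<open>k \<le> n\<close>.
\<close>

theorem prime_chain_length_le:
  fixes Q :: "nat \<Rightarrow> 'k::field mpoly set"
  assumes prime: "\<And>i. i \<le> k \<Longrightarrow> primeideal (Q i) (poly_ring n)"
    and strict: "\<And>i. i < k \<Longrightarrow> Q i \<subset> Q (Suc i)"
  shows "k \<le> n"
proof (rule ccontr)
  assume "\<not> k \<le> n"
  have "\<forall>i. \<exists>f. i < k \<longrightarrow> f \<in> Q (Suc i) - Q i" using strict by blast
  then obtain f where f: "\<And>i. i < k \<Longrightarrow> f i \<in> Q (Suc i) - Q i" by metis
  have f_polys: "f i \<in> polys n" if "i < k" for i
    using f[OF that] ideal_polysD[OF primeideal.axioms(1)[OF prime[of "Suc i"]]] that by simp
  define B where "B = Max (insert 0 (size ` (\<Union>i<k. mons (f i))))"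
  have B: "total_degree_le B (f i)" if "i < k" for i
    unfolding total_degree_le_def B_def using that by (auto intro!: Max_ge)
  (* The number of monomials of degree at most k d B is at most (k d B + 1)^n, which is at most
     d^n (k B + 1)^n. This is less than d^(n + 1) as soon as d exceeds (k B + 1)^n. *)
  define d where "d = (k * B + 1) ^ n + 1"
  define E where "E = {es. set es \<subseteq> {..<d} \<and> length es = k - 0}"
  define g where "g es = (\<Prod>i<length es. f (0 + i) ^ (es ! i))" for es
  define Y where "Y = {a. set_mset a \<subseteq> {1..n} \<and> size a \<le> k * (d * B)}"
  have finE: "finite E" and cardE: "card E = d ^ k"
    using finite_lists_length_eq[of "{..<d}" k] card_lists_length_eq[of "{..<d}" k] by (simp_all add: E_def)
  have d: "1 \<le> d" by (simp add: d_def)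
  have finY: "finite Y" unfolding Y_def by (rule monomials_degree_le)
  have "card Y \<le> (k * (d * B) + 1) ^ n" unfolding Y_def by (rule monomials_degree_le)
  also have "\<dots> \<le> (d * (k * B + 1)) ^ n" using d by (intro power_mono) (auto simp: algebra_simps)
  also have "\<dots> = d ^ n * (k * B + 1) ^ n" by (simp only: power_mult_distrib)
  also have "\<dots> < d ^ n * d" using d by (intro mult_strict_left_mono) (auto simp: d_def)
  also have "\<dots> = d ^ Suc n" by simp
  also have "\<dots> \<le> d ^ k" using d \<open>\<not> k \<le> n\<close> by (intro power_increasing) auto
  finally have "card Y < card E" using cardE by simp
  from nontrivial_solution[OF finY finE this, of "\<lambda>a es. coef (g es) a"]
  obtain c where c: "\<exists>es\<in>E. c es \<noteq> 0" "\<And>a. a \<in> Y \<Longrightarrow> (\<Sum>es\<in>E. coef (g es) a * c es) = 0" by blast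
  have gY: "mons (g es) \<subseteq> Y" if es: "es \<in> E" for es
  proof
    fix a assume a: "a \<in> mons (g es)"
    have len: "length es = k" using es by (simp add: E_def)
    have "total_degree_le (d * B) (f i ^ (es ! i))" if i: "i < k" for i
    proof -
      have "es ! i < d" using es i by (auto simp: E_def subset_iff)
      then have "es ! i * B \<le> d * B" by (intro mult_right_mono) auto
      then show ?thesis using total_degree_le_power[OF B[OF i], of "es ! i"]
        unfolding total_degree_le_def by (meson order_trans)
    qed
    then have "total_degree_le (k * (d * B)) (g es)"
      unfolding g_def len by (intro total_degree_le_prod) simp
    moreover have "g es \<in> polys n"
    proof -
      have "(\<Prod>i<l. f i ^ (es ! i)) \<in> polys n" if "l \<le> k" for l
        using that by (induction l) (auto intro!: polys_power f_polys)
      then show ?thesis by (simp add: g_def len)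
    qed
    ultimately show "a \<in> Y" using a unfolding Y_def total_degree_le_def mem_polys by blast
  qed
  have "(\<Sum>es\<in>E. Poly_Mapping.single 0 (c es) * g es) = 0"
  proof (rule poly_mapping_eqI)
    fix a
    have "coef (\<Sum>es\<in>E. Poly_Mapping.single 0 (c es) * g es) a = (\<Sum>es\<in>E. coef (g es) a * c es)"
      unfolding lookup_sum coef_const_mult by (simp only: mult.commute)
    also have "\<dots> = 0"
    proof (cases "a \<in> Y")
      case False
      then have "coef (g es) a = 0" if "es \<in> E" for es
        using gY[OF that] by (auto simp: mons_iff)
      then show ?thesis by simp
    qed (rule c(2))
    finally show "coef (\<Sum>es\<in>E. Poly_Mapping.single 0 (c es) * g es) a = coef 0 a" by simp
  qed
  moreover have "0 \<in> Q 0" by (rule ideal_polys_0[OF primeideal.axioms(1)[OF prime]]) simp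
  ultimately have mem: "(\<Sum>es\<in>E. Poly_Mapping.single 0 (c es) * g es) \<in> Q 0" by simp
  have "c es = 0" if "es \<in> E" for es
    by (rule prime_chain_independent[where Q = Q and k = k and f = f and j = 0 and d = d and n = n and E = E and g = g, OF prime _ f _ E_def g_def mem that])
      (use strict in auto)
  with c(1) show False by blast
qed

text \<open>
  A chain of primes that ends at \<open>(x\<^sub>1, \<dots>, x\<^sub>r)\<close> can be
  continued by adjoining the other \<open>n - r\<close> variables one at a time.
\<close>

lemma prime_height_var_prime_le:
  assumes "r \<le> n"
  shows "prime_height (poly_ring n) (var_prime n r :: 'k::field mpoly set) \<le> enat r"
  unfolding prime_height_def
proof (rule Sup_least, clarify)
  fix k and Q :: "nat \<Rightarrow> 'k mpoly set"
  assume Q: "\<forall>i\<le>k. primeideal (Q i) (poly_ring n)" "\<forall>i<k. Q i \<subset> Q (Suc i)" "Q k = var_prime n r"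
  (* The given chain up to its end Q k, followed by larger and larger sets of variables. *)
  define Q' where "Q' i = (if i \<le> k then Q i else var_prime n (r + (i - k)))" for i
  have "k + (n - r) \<le> n"
  proof (rule prime_chain_length_le)
    show "primeideal (Q' i) (poly_ring n)" for i
      using Q(1) primeideal_var_prime by (auto simp: Q'_def)
    show "Q' i \<subset> Q' (Suc i)" if "i < k + (n - r)" for i
    proof (cases "i < k")
      case True
      then show ?thesis using Q(2) by (simp add: Q'_def)
    next
      case False
      then have "Q' i = var_prime n (r + (i - k))" using Q(3) by (auto simp: Q'_def)
      moreover have "Q' (Suc i) = var_prime n (r + (Suc i - k))" using False by (simp add: Q'_def)
      moreover have "r + (Suc i - k) \<le> n" "r + (i - k) < r + (Suc i - k)" using False that assms by auto
      ultimately show ?thesis using var_prime_strict_mono by metis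
    qed
  qed
  then show "enat k \<le> enat r" using assms by simp
qed

lemma prime_height_ge:
  assumes P: "primeideal P (poly_ring n)" and var: "\<And>i. 1 \<le> i \<Longrightarrow> i \<le> r \<Longrightarrow> var i \<in> P" and "r \<le> n"
  shows "enat r \<le> prime_height (poly_ring n) (P :: 'k::field mpoly set)"
  unfolding prime_height_def
proof (rule Sup_upper, clarify, intro exI conjI refl)
  (* The last prime of the chain of variables is replaced by P, which may be larger. *)
  define Q where "Q i = (if i < r then var_prime n i else P)" for i
  show "\<forall>i\<le>r. primeideal (Q i) (poly_ring n)" using P primeideal_var_prime by (auto simp: Q_def)
  have "var_prime n i \<subset> P" if "i < r" for i
  proof -
    have "var_prime n i \<subset> (var_prime n r :: 'k mpoly set)"
      using var_prime_strict_mono that assms(3) by blast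
    also have "\<dots> \<subseteq> P" using var_prime_subset_ideal[OF primeideal.axioms(1)[OF P] var] by blast
    finally show ?thesis .
  qed
  moreover have "var_prime n i \<subset> (var_prime n (Suc i) :: 'k mpoly set)" if "Suc i < r" for i
    using var_prime_strict_mono[of i "Suc i" n] that assms(3) by simp
  ultimately show "\<forall>i<r. Q i \<subset> Q (Suc i)" by (simp add: Q_def)
  show "Q r = P" by (simp add: Q_def)
qed (rule refl)

text \<open>
  The squares in \<open>I\<close> force \<open>x\<^sub>1, \<dots>, x\<^sub>r\<close> into
  every prime over \<open>I\<close>, so \<open>(x\<^sub>1, \<dots>, x\<^sub>r)\<close> is
  the only minimal prime.
\<close>

theorem ideal_height_eq:
  fixes I :: "'k::field mpoly set"
  assumes sub: "I \<subseteq> var_prime n r" and sq: "\<And>i. 1 \<le> i \<Longrightarrow> i \<le> r \<Longrightarrow> var i * var i \<in> I" and r: "r \<le> n"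
  shows "ideal_height (poly_ring n) I = enat r"
proof (rule antisym)
  show "ideal_height (poly_ring n) I \<le> enat r"
    unfolding ideal_height_def
    by (rule INF_lower2[of "var_prime n r"]) (use primeideal_var_prime sub prime_height_var_prime_le r in auto)
  show "enat r \<le> ideal_height (poly_ring n) I"
    unfolding ideal_height_def
  proof (rule INF_greatest, clarify)
    fix P :: "'k mpoly set" assume P: "primeideal P (poly_ring n)" and IP: "I \<subseteq> P"
    have "var i \<in> P" if "1 \<le> i" "i \<le> r" for i
    proof -
      have "(var i :: 'k mpoly) \<in> polys n" using that r by simp
      then show ?thesis using primeideal.I_prime[OF P, of "var i" "var i"] sq[OF that] IP by auto
    qed
    then show "enat r \<le> prime_height (poly_ring n) P" by (rule prime_height_ge[OF P]) (use r in auto)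
  qed
qed

section \<open>The cell complex of a shifted diagram\<close>

text \<open>
  The cells of the grid: \<open>Vtx i j\<close> is the point in row \<open>i\<close> and
  column \<open>j\<close>, \<open>Hor i j\<close> and \<open>Ver i j\<close> are the edges
  from it to the next column and to the next row, and \<open>Sq i j\<close> is the unit
  square of which it is the first corner. \<open>Whole\<close> is the empty face, the basis
  element of the free module in homological degree 0.
\<close>

datatype cell = Whole | Vtx nat nat | Hor nat nat | Ver nat nat | Sq nat nat

text \<open>Homological degree, which exceeds the geometric dimension by one.\<close>

fun cell_dim :: "cell \<Rightarrow> nat" where
  "cell_dim Whole = 0"
| "cell_dim (Vtx i j) = 1"
| "cell_dim (Hor i j) = 2"
| "cell_dim (Ver i j) = 2"
| "cell_dim (Sq i j) = 3"

text \<open>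
  The coefficient of the second cell in the boundary of the first one: an incidence number
  times the quotient of the labels, where \<open>Vtx i j\<close> has the label
  \<open>t / (x\<^sub>i x\<^sub>j)\<close>, the edges \<open>Hor i j\<close> and
  \<open>Ver i j\<close> have \<open>t / x\<^sub>i\<close> and \<open>t / x\<^sub>j\<close>,
  and squares have \<open>t\<close>.
\<close>

fun bd :: "nat multiset \<Rightarrow> cell \<Rightarrow> cell \<Rightarrow> 'k::field mpoly" where
  "bd t (Vtx i j) Whole = monomial (t - {#i, j#})"
| "bd t (Hor i j) (Vtx k l) =
    (if k = i \<and> l = Suc j then var (Suc j) else if k = i \<and> l = j then - var j else 0)"
| "bd t (Ver i j) (Vtx k l) =
    (if k = Suc i \<and> l = j then var (Suc i) else if k = i \<and> l = j then - var i else 0)"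
| "bd t (Sq i j) (Hor k l) =
    (if k = i \<and> l = j then var i else if k = Suc i \<and> l = j then - var (Suc i) else 0)"
| "bd t (Sq i j) (Ver k l) =
    (if k = i \<and> l = Suc j then var (Suc j) else if k = i \<and> l = j then - var j else 0)"
| "bd t _ _ = 0"

text \<open>
  The degree of the label, which is \<open>size t - 2\<close>, \<open>size t - 1\<close> and
  \<open>size t\<close> for points, edges and squares.
\<close>

fun cell_degree :: "nat multiset \<Rightarrow> cell \<Rightarrow> int" where
  "cell_degree t Whole = 0"
| "cell_degree t c = int (size t) + int (cell_dim c) - 3"

text \<open>
  A finite set of boxes on or above the diagonal, closed under moving up, and under moving
  left as far as the diagonal. The monomial \<open>top\<close> is a proper multiple of every
  \<open>x\<^sub>i x\<^sub>j\<close>, so that no label of a point is 1.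
\<close>

locale shifted_diagram =
  fixes n :: nat and box :: "nat \<Rightarrow> nat \<Rightarrow> bool" and top :: "nat multiset"
  assumes box_ge: "box i j \<Longrightarrow> 1 \<le> i \<and> i \<le> j"
    and box_le: "box i j \<Longrightarrow> j \<le> n"
    and box_up: "box (Suc i) j \<Longrightarrow> 1 \<le> i \<Longrightarrow> box i j"
    and box_left: "box i (Suc j) \<Longrightarrow> i \<le> j \<Longrightarrow> box i j"
    and box_top: "box i j \<Longrightarrow> {#i, j#} \<subset># top"
    and top_vars: "set_mset top \<subseteq> {1..n}"
begin

text \<open>
  A cell is valid if all its corners are boxes; the closure properties allow only the
  extreme corners to be mentioned.
\<close>

fun valid :: "cell \<Rightarrow> bool" where
  "valid Whole \<longleftrightarrow> True"
| "valid (Vtx i j) \<longleftrightarrow> box i j"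
| "valid (Hor i j) \<longleftrightarrow> i \<le> j \<and> box i (Suc j)"
| "valid (Ver i j) \<longleftrightarrow> 1 \<le> i \<and> box (Suc i) j"
| "valid (Sq i j) \<longleftrightarrow> 1 \<le> i \<and> i < j \<and> box (Suc i) (Suc j)"

definition cells :: "nat \<Rightarrow> cell set" where
  "cells d = {c. valid c \<and> cell_dim c = d}"

lemma in_cells [simp]: "c \<in> cells d \<longleftrightarrow> valid c \<and> cell_dim c = d"
  by (simp add: cells_def)

lemma finite_cells: "finite (cells d)"
proof (rule finite_subset)
  let ?S = "{..n} \<times> {..n}"
  show "cells d \<subseteq> {Whole} \<union> (\<lambda>(i, j). Vtx i j) ` ?S \<union> (\<lambda>(i, j). Hor i j) ` ?S
      \<union> (\<lambda>(i, j). Ver i j) ` ?S \<union> (\<lambda>(i, j). Sq i j) ` ?S" (is "_ \<subseteq> ?C")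
  proof
    fix c assume "c \<in> cells d"
    then have v: "valid c" by simp
    have *: "(i, j) \<in> ?S" if "valid (Vtx i j) \<or> valid (Hor i j) \<or> valid (Ver i j) \<or> valid (Sq i j)" for i j
      using that box_ge[of i j] box_le[of i j] box_ge[of i "Suc j"] box_le[of i "Suc j"]
        box_ge[of "Suc i" j] box_le[of "Suc i" j] box_ge[of "Suc i" "Suc j"] box_le[of "Suc i" "Suc j"]
      by auto
    show "c \<in> ?C"
    proof (cases c)
      case (Vtx i j)
      then show ?thesis using *[of i j] v by blast
    next
      case (Hor i j)
      then show ?thesis using *[of i j] v by blast
    next
      case (Ver i j)
      then show ?thesis using *[of i j] v by blast
    next
      case (Sq i j)
      then show ?thesis using *[of i j] v by blast
    qed simp
  qed
qed auto

lemma box_leftwards: "k \<le> j \<Longrightarrow> box i j \<Longrightarrow> i \<le> k \<Longrightarrow> box i k"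
proof (induction rule: inc_induct)
  case (step k)
  then show ?case using box_left[of i k] by simp
qed

lemma cells_0: "cells 0 = {Whole}"
proof (rule Set.set_eqI)
  show "c \<in> cells 0 \<longleftrightarrow> c \<in> {Whole}" for c by (cases c) simp_all
qed

lemma cells_ge_4: "cells (Suc (Suc (Suc (Suc d)))) = {}"
proof (rule Set.set_eqI)
  show "c \<in> cells (Suc (Suc (Suc (Suc d)))) \<longleftrightarrow> c \<in> {}" for c by (cases c) simp_all
qed

text \<open>
  Boundaries of chains, written out at a single cell. The chains vanish outside the valid
  cells, so that the formulas need no case distinction at the border of the diagram.
\<close>

lemma sum_bd_Hor:
  assumes "\<And>c. \<not> valid c \<Longrightarrow> z c = 0" "1 \<le> k"
  shows "(\<Sum>c\<in>cells 3. bd t c (Hor k l) * z c) = var k * (z (Sq k l) - z (Sq (k - 1) l))"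
proof -
  have "(\<Sum>c\<in>cells 3. bd t c (Hor k l) * z c) = (\<Sum>c\<in>{Sq k l, Sq (k - 1) l}. bd t c (Hor k l) * z c)"
  proof (rule sum.mono_neutral_cong)
    fix c assume "c \<in> cells 3 - {Sq k l, Sq (k - 1) l}"
    then show "bd t c (Hor k l) * z c = 0" using assms(2) by (cases c) auto
  qed (use assms finite_cells in auto)
  then show ?thesis using assms(2) by (simp add: algebra_simps)
qed

lemma sum_bd_Ver:
  assumes "\<And>c. \<not> valid c \<Longrightarrow> z c = 0" "1 \<le> l"
  shows "(\<Sum>c\<in>cells 3. bd t c (Ver k l) * z c) = var l * (z (Sq k (l - 1)) - z (Sq k l))"
proof -
  have "(\<Sum>c\<in>cells 3. bd t c (Ver k l) * z c) = (\<Sum>c\<in>{Sq k l, Sq k (l - 1)}. bd t c (Ver k l) * z c)"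
  proof (rule sum.mono_neutral_cong)
    fix c assume "c \<in> cells 3 - {Sq k l, Sq k (l - 1)}"
    then show "bd t c (Ver k l) * z c = 0" using assms(2) by (cases c) auto
  qed (use assms finite_cells in auto)
  then show ?thesis using assms(2) by (simp add: algebra_simps)
qed

lemma sum_bd_Vtx:
  assumes "\<And>c. \<not> valid c \<Longrightarrow> z c = 0" "1 \<le> k" "1 \<le> l"
  shows "(\<Sum>c\<in>cells 2. bd t c (Vtx k l) * z c) =
    var l * (z (Hor k (l - 1)) - z (Hor k l)) + var k * (z (Ver (k - 1) l) - z (Ver k l))"
proof -
  have "(\<Sum>c\<in>cells 2. bd t c (Vtx k l) * z c)
      = (\<Sum>c\<in>{Hor k (l - 1), Hor k l, Ver (k - 1) l, Ver k l}. bd t c (Vtx k l) * z c)"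
  proof (rule sum.mono_neutral_cong)
    fix c assume "c \<in> cells 2 - {Hor k (l - 1), Hor k l, Ver (k - 1) l, Ver k l}"
    then show "bd t c (Vtx k l) * z c = 0" using assms(2,3) by (cases c) auto
  qed (use assms finite_cells in auto)
  then show ?thesis using assms(2,3) by (simp add: algebra_simps)
qed

lemma monomial_diff_mult_var:
  assumes "{#a, b#} \<subseteq># t"
  shows "monomial (t - {#a, b#}) * var a = (monomial (t - {#b#}) :: 'k::field mpoly)"
    and "monomial (t - {#a, b#}) * var b = (monomial (t - {#a#}) :: 'k::field mpoly)"
proof -
  obtain s where t: "t = {#a, b#} + s" using assms by (metis subset_mset.le_iff_add)
  show "monomial (t - {#a, b#}) * var a = (monomial (t - {#b#}) :: 'k mpoly)"
    unfolding t by (simp add: add_mset_commute[of a b] flip: monomial_add)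
  show "monomial (t - {#a, b#}) * var b = (monomial (t - {#a#}) :: 'k mpoly)"
    unfolding t by (simp flip: monomial_add)
qed

lemma bd_bd_edge:
  assumes "c \<in> cells 2"
  shows "(\<Sum>v\<in>cells 1. bd top c v * bd top v Whole) = (0 :: 'k::field mpoly)"
proof (cases c)
  case (Hor i j)
  then have b: "box i j" "box i (Suc j)" using assms box_left by auto
  note eq = monomial_diff_mult_var[OF subset_mset.less_imp_le[OF box_top[OF b(1)]], where ?'k = 'k]
    monomial_diff_mult_var[OF subset_mset.less_imp_le[OF box_top[OF b(2)]], where ?'k = 'k]
  have "(\<Sum>v\<in>cells 1. bd top c v * bd top v Whole)
      = (\<Sum>v\<in>{Vtx i j, Vtx i (Suc j)}. bd top c v * (bd top v Whole :: 'k mpoly))"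
  proof (rule sum.mono_neutral_right[OF finite_cells], use b in simp, rule ballI)
    fix v assume "v \<in> cells 1 - {Vtx i j, Vtx i (Suc j)}"
    then have "bd top c v = (0 :: 'k mpoly)" using Hor by (cases v) auto
    then show "bd top c v * bd top v Whole = (0 :: 'k mpoly)" by simp
  qed
  then show ?thesis using eq by (simp add: Hor mult.commute[of "var _"])
next
  case (Ver i j)
  then have b: "box i j" "box (Suc i) j" using assms box_up by auto
  note eq = monomial_diff_mult_var[OF subset_mset.less_imp_le[OF box_top[OF b(1)]], where ?'k = 'k]
    monomial_diff_mult_var[OF subset_mset.less_imp_le[OF box_top[OF b(2)]], where ?'k = 'k]
  have "(\<Sum>v\<in>cells 1. bd top c v * bd top v Whole)
      = (\<Sum>v\<in>{Vtx i j, Vtx (Suc i) j}. bd top c v * (bd top v Whole :: 'k mpoly))"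
  proof (rule sum.mono_neutral_right[OF finite_cells], use b in simp, rule ballI)
    fix v assume "v \<in> cells 1 - {Vtx i j, Vtx (Suc i) j}"
    then have "bd top c v = (0 :: 'k mpoly)" using Ver by (cases v) auto
    then show "bd top c v * bd top v Whole = (0 :: 'k mpoly)" by simp
  qed
  then show ?thesis using eq by (simp add: Ver mult.commute[of "var _"])
qed (use assms in auto)

lemma bd_bd_square:
  assumes "c \<in> cells 3" "v \<in> cells 1"
  shows "(\<Sum>e\<in>cells 2. bd t c e * bd t e v) = (0 :: 'k::field mpoly)"
proof -
  obtain i j where c: "c = Sq i j" using assms by (cases c) auto
  then have ij: "1 \<le> i" "i < j" "box (Suc i) (Suc j)" using assms by auto
  then have b: "box i (Suc j)" "box (Suc i) j" using box_up[of i "Suc j"] box_left[of "Suc i" j] by auto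
  obtain k l where v: "v = Vtx k l" using assms by (cases v) auto
  have "(\<Sum>e\<in>cells 2. bd t c e * bd t e v)
      = (\<Sum>e\<in>{Hor i j, Hor (Suc i) j, Ver i j, Ver i (Suc j)}. bd t c e * (bd t e v :: 'k mpoly))"
  proof (rule sum.mono_neutral_right[OF finite_cells], use b ij in simp, rule ballI)
    fix e assume "e \<in> cells 2 - {Hor i j, Hor (Suc i) j, Ver i j, Ver i (Suc j)}"
    then have "bd t c e = (0 :: 'k mpoly)" using c by (cases e) auto
    then show "bd t c e * bd t e v = (0 :: 'k mpoly)" by simp
  qed
  also have "\<dots> = var i * bd t (Hor i j) (Vtx k l) - var (Suc i) * bd t (Hor (Suc i) j) (Vtx k l)
      - var j * bd t (Ver i j) (Vtx k l) + var (Suc j) * bd t (Ver i (Suc j)) (Vtx k l)"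
    by (simp add: c v)
  also have "\<dots> = 0"
  proof -
    consider "k = i" "l = j" | "k = i" "l = Suc j" | "k = Suc i" "l = j" | "k = Suc i" "l = Suc j"
      | "k \<noteq> i" "k \<noteq> Suc i" | "l \<noteq> j" "l \<noteq> Suc j" by blast
    then show ?thesis by cases (simp_all add: mult_ac)
  qed
  finally show ?thesis .
qed

section \<open>Exactness of the cellular complex\<close>

text \<open>
  The horizontal edge in row \<open>k\<close> belongs only to the squares in rows
  \<open>k\<close> and \<open>k - 1\<close>, so a cycle of squares is constant down each
  column, starting from 0.
\<close>

lemma exact_squares:
  fixes z :: "cell \<Rightarrow> 'k::field mpoly"
  assumes z0: "\<And>c. c \<notin> cells 3 \<Longrightarrow> z c = 0"
    and cycle: "\<And>e. e \<in> cells 2 \<Longrightarrow> (\<Sum>c\<in>cells 3. bd t c e * z c) = 0"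
  shows "z c = 0"
proof -
  have inv: "\<not> valid c \<Longrightarrow> z c = 0" for c using z0 by simp
  have sq: "z (Sq k l) = 0" for k l
  proof (induction k)
    case 0
    then show ?case by (simp add: z0)
  next
    case (Suc k)
    show ?case
    proof (cases "valid (Sq (Suc k) l)")
      case True
      then have "valid (Hor (Suc k) l)" using box_up[of "Suc k" "Suc l"] by simp
      then have "var (Suc k) * z (Sq (Suc k) l) = 0"
        using cycle[of "Hor (Suc k) l"] sum_bd_Hor[of z "Suc k" t l, OF inv] Suc by simp
      then show ?thesis by simp
    qed (rule inv)
  qed
  show ?thesis using sq z0[of c] by (cases c) auto
qed

text \<open>
  If \<open>z\<close> is the boundary of \<open>w\<close>, its value on
  \<open>Hor i j\<close> is \<open>x\<^sub>i (w (Sq i j) - w (Sq (i - 1) j))\<close>, which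
  forces \<open>w (Sq i j)\<close> to be the sum \<open>W i j\<close> of the quotients by
  \<open>x\<^sub>k\<close> of the values on \<open>Hor k j\<close> over
  \<open>k \<le> i\<close>. What has to be shown is that these divisions are exact, that
  \<open>W\<close> also yields the values on vertical edges, and that \<open>W\<close>
  vanishes where there is no square. The three claims are proved together, row by row and
  within a row from the diagonal to the right, from the cycle condition at one point at a
  time.
\<close>

lemma exact_edges:
  fixes z :: "cell \<Rightarrow> 'k::field mpoly"
  assumes z_polys: "\<And>c. z c \<in> polys n" and z0: "\<And>c. c \<notin> cells 2 \<Longrightarrow> z c = 0"
    and cycle: "\<And>v. v \<in> cells 1 \<Longrightarrow> (\<Sum>c\<in>cells 2. bd t c v * z c) = 0"
  shows "\<exists>w. (\<forall>c. w c \<in> polys n) \<and> (\<forall>e\<in>cells 2. z e = (\<Sum>c\<in>cells 3. bd t c e * w c))"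
proof -
  define a where "a i j = z (Hor i j)" for i j
  define b where "b i j = z (Ver i j)" for i j
  define W where "W i j = (\<Sum>k=1..i. var_quot k (a k j))" for i j
  have a0: "a i j = 0" if "\<not> (i \<le> j \<and> box i (Suc j))" for i j
    using that by (auto simp: a_def z0)
  have b0: "b i j = 0" if "\<not> (1 \<le> i \<and> box (Suc i) j)" for i j
    using that by (auto simp: b_def z0)
  have eq: "var j * (a i (j - 1) - a i j) + var i * (b (i - 1) j - b i j) = 0" if "box i j" for i j
    using cycle[of "Vtx i j"] that box_ge[OF that] sum_bd_Vtx[of z i j t] z0
    by (simp add: a_def b_def)
  have W_Suc: "W (Suc i) j = W i j + var_quot (Suc i) (a (Suc i) j)" for i j
    by (simp add: W_def)
  have W_large: "W i j = 0" if "n \<le> j" for i j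
  proof -
    have "a k j = 0" for k using box_le[of k "Suc j"] that by (intro a0) auto
    then show ?thesis by (simp add: W_def)
  qed
  (* In this order: the divisions in row i are exact; W yields the values on the vertical edges
     that leave row i; W vanishes at the points of row i that are not the first corner of a
     square, and on the diagonal. *)
  have main: "(1 \<le> i \<longrightarrow> (\<forall>j. var i * var_quot i (a i j) = a i j)) \<and>
    (\<forall>j\<ge>i. b i (Suc j) = var (Suc j) * (W i j - W i (Suc j))) \<and>
    (\<forall>j\<ge>i. \<not> box (Suc i) (Suc j) \<longrightarrow> W i j = 0) \<and> W i i = 0" for i
  proof (induction i)
    case 0
    then show ?case by (simp add: W_def b0)
  next
    case (Suc i)
    let ?r = "Suc i"
    from Suc have B: "\<And>j. i \<le> j \<Longrightarrow> b i (Suc j) = var (Suc j) * (W i j - W i (Suc j))"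
      and C: "\<And>j. i \<le> j \<Longrightarrow> \<not> box ?r (Suc j) \<Longrightarrow> W i j = 0" and Wii: "W i i = 0" by auto
    (* At a diagonal point there are no edges to the left and downwards, so the cycle condition
       determines the value on the edge to the right from the one on the edge above. *)
    have start: "var ?r * var_quot ?r (a ?r ?r) = a ?r ?r \<and> W ?r ?r = 0"
    proof (cases "box ?r ?r")
      case True
      have "a ?r i = 0" "b ?r ?r = 0" using box_ge[of ?r ?r] box_ge[of "Suc ?r" ?r] by (auto intro: a0 b0)
      then have "- (var ?r * (a ?r ?r + var ?r * W i ?r)) = 0"
        using eq[OF True] B[of i] Wii by (simp add: algebra_simps)
      then have "a ?r ?r + var ?r * W i ?r = 0" by simp
      then have a_eq: "a ?r ?r = var ?r * (- W i ?r)" by (simp add: eq_neg_iff_add_eq_0)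
      have "var_quot ?r (a ?r ?r) = - W i ?r" unfolding a_eq by (rule var_quot_mult)
      with a_eq show ?thesis by (simp add: W_Suc)
    next
      case False
      then have "\<not> box ?r (Suc ?r)" using box_left[of ?r ?r] by auto
      then have "a ?r ?r = 0" "W i ?r = 0" using C[of ?r] by (auto intro: a0)
      then show ?thesis by (simp add: W_Suc)
    qed
    have step: "var ?r * var_quot ?r (a ?r (Suc j)) = a ?r (Suc j) \<and>
      b ?r (Suc j) = var (Suc j) * (W ?r j - W ?r (Suc j))"
      if j: "?r \<le> j" and IH: "var ?r * var_quot ?r (a ?r j) = a ?r j" for j
    proof (cases "box ?r (Suc j)")
      case True
      define c where "c = var_quot (Suc j) (b ?r (Suc j))"
      (* The cycle condition at the next point, with the value on the edge above replaced by its
         expression in W. The two variables are distinct because the point is off the diagonal. *)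
      have e: "var (Suc j) * (a ?r j - a ?r (Suc j) + var ?r * (W i j - W i (Suc j))) = var ?r * b ?r (Suc j)"
        using eq[OF True] B[of j] j by (simp add: algebra_simps)
      then have bc: "b ?r (Suc j) = var (Suc j) * c"
        unfolding c_def using var_multiple_other_var[OF e] j by simp
      have "var (Suc j) * (a ?r j - a ?r (Suc j) + var ?r * (W i j - W i (Suc j))) = var (Suc j) * (var ?r * c)"
        unfolding e bc by (simp add: mult_ac)
      then have "a ?r j - a ?r (Suc j) + var ?r * (W i j - W i (Suc j)) = var ?r * c"
        using mult_left_cancel[OF monomial_nonzero] by blast
      then have "a ?r (Suc j) = a ?r j + var ?r * (W i j - W i (Suc j)) - var ?r * c"
        by (simp add: algebra_simps)
      then have a': "a ?r (Suc j) = var ?r * (var_quot ?r (a ?r j) + W i j - W i (Suc j) - c)"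
        using IH by (simp add: algebra_simps)
      have q: "var_quot ?r (a ?r (Suc j)) = var_quot ?r (a ?r j) + W i j - W i (Suc j) - c"
        unfolding a' by (rule var_quot_mult)
      have "W ?r j - W ?r (Suc j) = c" unfolding W_Suc q by simp
      then show ?thesis using bc q a' by simp
    next
      case False
      then have "\<not> box ?r (Suc (Suc j))" using box_left[of ?r "Suc j"] j by auto
      moreover have "\<not> box (Suc ?r) (Suc j)" using False box_up[of ?r "Suc j"] by auto
      ultimately have "a ?r j = 0" "a ?r (Suc j) = 0" "b ?r (Suc j) = 0" "W i j = 0" "W i (Suc j) = 0"
        using False C[of j] C[of "Suc j"] j a0[of ?r j] a0[of ?r "Suc j"] b0[of ?r "Suc j"] by simp_all
      then show ?thesis by (simp add: W_Suc)
    qed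
    have A: "var ?r * var_quot ?r (a ?r j) = a ?r j" for j
    proof (cases "?r \<le> j")
      case True
      then show ?thesis by (induction j rule: dec_induct) (use start step in simp_all)
    qed (simp add: a0)
    have B': "b ?r (Suc j) = var (Suc j) * (W ?r j - W ?r (Suc j))" if "?r \<le> j" for j
      using step[OF that A] by simp
    have C': "W ?r j = 0" if j: "?r \<le> j" and nb: "\<not> box (Suc ?r) (Suc j)" for j
    proof -
      have down: "W ?r j' = W ?r (Suc j')" if "j \<le> j'" for j'
      proof -
        have "\<not> box (Suc ?r) (Suc j')"
          using nb box_leftwards[of "Suc j" "Suc j'" "Suc ?r"] that j by auto
        then have "var (Suc j') * (W ?r j' - W ?r (Suc j')) = 0"
          using B'[of j'] j that by (simp add: b0)
        then show ?thesis by simp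
      qed
      show ?thesis
      proof (cases "n \<le> j")
        case False
        then have "j \<le> n" by simp
        have "k \<le> n \<Longrightarrow> j \<le> k \<Longrightarrow> W ?r k = 0" for k
        proof (induction k rule: inc_induct)
          case (step k)
          then show ?case using down[of k] by simp
        qed (simp add: W_large)
        then show ?thesis using \<open>j \<le> n\<close> by blast
      qed (rule W_large)
    qed
    show ?case
    proof (intro conjI allI impI)
      show "var ?r * var_quot ?r (a ?r j) = a ?r j" for j by (rule A)
      show "b ?r (Suc j) = var (Suc j) * (W ?r j - W ?r (Suc j))" if "?r \<le> j" for j
        using that by (rule B')
      show "W ?r j = 0" if "?r \<le> j" "\<not> box (Suc ?r) (Suc j)" for j
        using that by (rule C')
      show "W ?r ?r = 0" using start ..
    qed
  qed
  define w where "w c = (case c of Sq i j \<Rightarrow> if valid c then W i j else 0 | _ \<Rightarrow> 0)" for c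
  have W_polys: "W i j \<in> polys n" for i j
    unfolding W_def a_def by (intro polys_sum var_quot_in_polys z_polys)
  have w0: "w c = 0" if "\<not> valid c" for c using that by (auto simp: w_def split: cell.splits)
  have w_Sq: "w (Sq i j) = W i j" if "i \<le> j" for i j
  proof (cases "valid (Sq i j)")
    case False
    have "W i j = 0"
    proof (cases "i = 0 \<or> i = j")
      case True
      then show ?thesis using main[of i] by (auto simp: W_def)
    next
      case False
      with that \<open>\<not> valid (Sq i j)\<close> have "\<not> box (Suc i) (Suc j)" by auto
      then show ?thesis using main[of i] that by simp
    qed
    with False show ?thesis by (simp add: w_def)
  qed (simp add: w_def)
  have "z e = (\<Sum>c\<in>cells 3. bd t c e * w c)" if e: "e \<in> cells 2" for e
  proof (cases e)
    case (Hor i j)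
    with e have ij: "i \<le> j" "box i (Suc j)" "1 \<le> i" using box_ge[of i "Suc j"] by auto
    then have "w (Sq i j) = W i j" "w (Sq (i - 1) j) = W (i - 1) j" by (auto intro!: w_Sq)
    moreover have "var_quot i (a i j) = W i j - W (i - 1) j" using W_Suc[of "i - 1" j] ij(3) by simp
    moreover have "a i j = var i * var_quot i (a i j)" using main[of i] ij(3) by metis
    ultimately have "a i j = var i * (w (Sq i j) - w (Sq (i - 1) j))" by metis
    also have "\<dots> = (\<Sum>c\<in>cells 3. bd t c e * w c)"
      unfolding Hor by (rule sum_bd_Hor[OF w0 ij(3), symmetric])
    finally show ?thesis by (simp add: Hor a_def)
  next
    case (Ver i j)
    with e have ij: "1 \<le> i" "box (Suc i) j" "Suc i \<le> j" using box_ge[of "Suc i" j] by auto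
    then have j1: "1 \<le> j" by linarith
    have "w (Sq i j) = W i j" "w (Sq i (j - 1)) = W i (j - 1)" using ij by (auto intro!: w_Sq)
    moreover have "b i j = var j * (W i (j - 1) - W i j)" using conjunct1[OF conjunct2[OF main[of i]]] ij by (cases j) auto
    ultimately have "b i j = var j * (w (Sq i (j - 1)) - w (Sq i j))" by metis
    also have "\<dots> = (\<Sum>c\<in>cells 3. bd t c e * w c)"
      unfolding Ver by (rule sum_bd_Ver[OF w0 j1, symmetric])
    finally show ?thesis by (simp add: Ver b_def)
  qed (use e in auto)
  moreover have "w c \<in> polys n" for c using W_polys by (auto simp: w_def split: cell.splits)
  ultimately show ?thesis by blast
qed

text \<open>
  Let \<open>a\<close> be a monomial of the coefficient at the last point
  \<open>(i, j)\<close> of the syzygy. In the syzygy,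
  \<open>a t / (x\<^sub>i x\<^sub>j)\<close> must cancel against a multiple of
  \<open>t / (x\<^sub>k x\<^sub>l)\<close> for an earlier point \<open>(k, l)\<close>. So
  \<open>x\<^sub>i x\<^sub>j\<close> divides \<open>a x\<^sub>k x\<^sub>l\<close>, and as
  the two points differ, \<open>x\<^sub>i\<close> or \<open>x\<^sub>j\<close> divides
  \<open>a\<close>. The side conditions say that the matching edge exists: the upper
  neighbour for \<open>x\<^sub>i\<close>, the left one for \<open>x\<^sub>j\<close>.
\<close>

lemma vertex_syzygy_leading_coefficient:
  fixes p :: "cell \<Rightarrow> 'k::field mpoly"
  assumes p0: "\<And>v. v \<notin> cells 1 \<Longrightarrow> p v = 0"
    and syz: "(\<Sum>v\<in>cells 1. bd top v Whole * p v) = 0"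
    and box: "box i j"
    and lead: "\<And>k l. box k l \<Longrightarrow> i < k \<or> (i = k \<and> j < l) \<Longrightarrow> p (Vtx k l) = 0"
    and a: "a \<in> mons (p (Vtx i j))"
  shows "(1 < i \<and> i \<in># a) \<or> (i < j \<and> j \<in># a)"
proof -
  define b where "b = top - {#i, j#} + a"
  have mem: "Vtx i j \<in> cells 1" using box by simp
  have "b \<in> mons (bd top (Vtx i j) Whole * p (Vtx i j))"
    using a by (simp add: mons_monomial_mult b_def)
  then have "coef (bd top (Vtx i j) Whole * p (Vtx i j)) b \<noteq> 0" unfolding mons_iff .
  moreover have "(\<Sum>v\<in>cells 1. coef (bd top v Whole * p v) b) = 0"
    using syz by (simp flip: lookup_sum)
  ultimately have "(\<Sum>v\<in>cells 1 - {Vtx i j}. coef (bd top v Whole * p v) b) \<noteq> 0"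
    unfolding sum.remove[OF finite_cells mem] by (metis add.right_neutral)
  then have "\<exists>v\<in>cells 1 - {Vtx i j}. coef (bd top v Whole * p v) b \<noteq> 0"
    by (meson sum.neutral)
  then obtain v where v: "v \<in> cells 1" "v \<noteq> Vtx i j" "b \<in> mons (bd top v Whole * p v)"
    unfolding mons_iff by blast
  then obtain k l where kl: "v = Vtx k l" "box k l" by (cases v) auto
  from v(3) kl(1) obtain c where c: "b = top - {#k, l#} + c" "c \<in> mons (p (Vtx k l))"
    by (auto simp: mons_monomial_mult)
  then have "p (Vtx k l) \<noteq> 0" by auto
  with lead[OF kl(2)] v(2) kl(1) have before: "k < i \<or> (k = i \<and> l < j)" by (metis linorder_neqE_nat)
  have count: "count {#i, j#} x \<le> count {#k, l#} x + count a x" for x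
  proof -
    have "count {#i, j#} x \<le> count top x" "count {#k, l#} x \<le> count top x"
      using box_top[OF box] box_top[OF kl(2)] by (metis mset_subset_eq_count subset_mset.less_imp_le)+
    moreover have "count (top - {#i, j#}) x + count a x = count (top - {#k, l#}) x + count c x"
      using c(1) unfolding b_def by (metis count_union)
    ultimately show ?thesis unfolding count_diff by linarith
  qed
  have ij: "1 \<le> i" "i \<le> j" and kl': "1 \<le> k" "k \<le> l"
    using box_ge[OF box] box_ge[OF kl(2)] by auto
  from before show ?thesis
  proof
    assume "k < i"
    show ?thesis
    proof (cases "i \<in># a")
      case False
      then have "count {#i, j#} i \<le> count {#k, l#} i" using count[of i] by (simp add: not_in_iff)
      with \<open>k < i\<close> have "l = i" "j \<noteq> i" by (auto split: if_splits)
      then have "j \<in># a" using count[of j] \<open>k < i\<close> ij by (cases "j \<in># a") (auto simp: not_in_iff split: if_splits)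
      with \<open>j \<noteq> i\<close> ij show ?thesis by auto
    qed (use \<open>k < i\<close> kl' in auto)
  next
    assume kl_less: "k = i \<and> l < j"
    then have "i < j" using kl' by simp
    moreover have "j \<in># a"
      using count[of j] kl_less \<open>i < j\<close> by (cases "j \<in># a") (auto simp: not_in_iff split: if_splits)
    ultimately show ?thesis by blast
  qed
qed

lemma bd_graded_minimal:
  assumes cc: "c \<in> cells (Suc i)" "c' \<in> cells i"
  shows "(bd top c c' :: 'k::field mpoly) \<in> polys n \<and> homogeneous (cell_degree top c - cell_degree top c') (bd top c c' :: 'k mpoly) \<and>
    const_coef (bd top c c' :: 'k mpoly) = 0"
proof -
  have hv: "homogeneous 1 (var x :: 'k mpoly)" "homogeneous 1 (- var x :: 'k mpoly)" "homogeneous e (0 :: 'k mpoly)" for x e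
    by (simp_all add: homogeneous_def mons_iff coef_monomial)
  have v0: "const_coef (var x :: 'k mpoly) = 0" for x by (simp add: coef_monomial)
  have vp: "var x \<in> (polys n :: 'k mpoly set)" if "1 \<le> x" "x \<le> n" for x using that by simp
  have valid: "valid c" "valid c'" using cc by auto
  show ?thesis
  proof (cases c)
    case Whole
    then show ?thesis using cc by simp
  next
    case (Vtx k l)
    with cc have "i = 0" by simp
    with cc(2) have c': "c' = Whole" using cells_0 by blast
    from Vtx valid have box: "box k l" by simp
    have "top - {#k, l#} \<noteq> {#}"
      using box_top[OF box] by (metis Diff_eq_empty_iff_mset subset_mset.less_le_not_le)
    moreover have "int (size (top - {#k, l#})) = int (size top) - 2"
      using size_Diff_submset[of "{#k, l#}" top] size_mset_mono[of "{#k, l#}" top] box_top[OF box]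
      by (simp add: subset_mset.less_imp_le)
    moreover have "set_mset (top - {#k, l#}) \<subseteq> {1..n}" using top_vars by (auto dest: in_diffD)
    ultimately show ?thesis by (simp add: Vtx c' homogeneous_def coef_monomial)
  next
    case (Hor k l)
    with valid have "k \<le> l" "box k (Suc l)" by auto
    then have "1 \<le> l" "Suc l \<le> n" using box_ge[of k "Suc l"] box_le[of k "Suc l"] by auto
    then have vps: "var l \<in> (polys n :: 'k mpoly set)" "var (Suc l) \<in> (polys n :: 'k mpoly set)" by simp_all
    from cc Hor have "i = 1" by simp
    with cc obtain k' l' where c': "c' = Vtx k' l'" by (cases c') auto
    show ?thesis using vps hv v0 by (simp add: Hor c')
  next
    case (Ver k l)
    with valid have "1 \<le> k" "box (Suc k) l" by auto
    then have "Suc k \<le> n" using box_ge[of "Suc k" l] box_le[of "Suc k" l] by auto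
    with \<open>1 \<le> k\<close> have vps: "var k \<in> (polys n :: 'k mpoly set)" "var (Suc k) \<in> (polys n :: 'k mpoly set)" by simp_all
    from cc Ver have "i = 1" by simp
    with cc obtain k' l' where c': "c' = Vtx k' l'" by (cases c') auto
    show ?thesis using vps hv v0 by (simp add: Ver c')
  next
    case (Sq k l)
    with valid have "1 \<le> k" "k < l" "box (Suc k) (Suc l)" by auto
    then have "Suc k \<le> n" "Suc l \<le> n" using box_ge[of "Suc k" "Suc l"] box_le[of "Suc k" "Suc l"] by auto
    with \<open>1 \<le> k\<close> \<open>k < l\<close> have vps: "var k \<in> (polys n :: 'k mpoly set)" "var (Suc k) \<in> (polys n :: 'k mpoly set)"
      "var l \<in> (polys n :: 'k mpoly set)" "var (Suc l) \<in> (polys n :: 'k mpoly set)" by simp_all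
    from cc Sq have "i = 2" by simp
    with cc(2) show ?thesis using vps hv v0 by (cases c') (simp_all add: Sq)
  qed
qed

text \<open>
  Subtracting the boundaries of the left and upper edge of the last point in the support,
  with suitable coefficients, removes that point from the syzygy. The induction is on the
  position in row-major order, \<open>i (n + 1) + j\<close>.
\<close>

lemma exact_vertices:
  fixes p :: "cell \<Rightarrow> 'k::field mpoly"
  assumes "\<And>v. p v \<in> polys n" and "\<And>v. v \<notin> cells 1 \<Longrightarrow> p v = 0"
    and "(\<Sum>v\<in>cells 1. bd top v Whole * p v) = 0"
  shows "\<exists>w. (\<forall>c. w c \<in> polys n) \<and> (\<forall>v\<in>cells 1. p v = (\<Sum>e\<in>cells 2. bd top e v * w e))"
proof -
  have "\<exists>w. (\<forall>c. w c \<in> polys n) \<and> (\<forall>v\<in>cells 1. p v = (\<Sum>e\<in>cells 2. bd top e v * w e))"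
    if "\<And>v. p v \<in> polys n" "\<And>v. v \<notin> cells 1 \<Longrightarrow> p v = 0"
      "(\<Sum>v\<in>cells 1. bd top v Whole * p v) = 0"
      "\<And>k l. box k l \<Longrightarrow> N \<le> k * Suc n + l \<Longrightarrow> p (Vtx k l) = 0"
    for N and p :: "cell \<Rightarrow> 'k mpoly"
    using that
  proof (induction N arbitrary: p)
    case 0
    have "p v = 0" if "v \<in> cells 1" for v using 0(4) that by (cases v) auto
    then show ?case by (intro exI[of _ "\<lambda>_. 0"]) auto
  next
    case (Suc N)
    show ?case
    proof (cases "\<exists>i j. box i j \<and> i * Suc n + j = N")
      case False
      have "p (Vtx k l) = 0" if "box k l" "N \<le> k * Suc n + l" for k l
        using Suc.prems(4)[OF that(1)] False that by (cases "N = k * Suc n + l") auto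
      then show ?thesis using Suc.IH[of p] Suc.prems by blast
    next
      case True
      then obtain i j where box: "box i j" and N: "i * Suc n + j = N" by blast
      have ij: "1 \<le> i" "i \<le> j" "j \<le> n" using box_ge[OF box] box_le[OF box] by auto
      have rank: "i * Suc n + j < k * Suc n + l" if "box k l" "i < k \<or> (i = k \<and> j < l)" for k l
      proof (cases "i < k")
        case True
        then have "Suc i * Suc n \<le> k * Suc n" by (intro mult_right_mono) auto
        then show ?thesis using ij by simp
      qed (use that in auto)
      have lead: "p (Vtx k l) = 0" if "box k l" "i < k \<or> (i = k \<and> j < l)" for k l
        using Suc.prems(4)[OF that(1)] rank[OF that] N by simp
      (* Monomials divisible by the variable of the row are assigned to the upper edge if there
         is one, all others to the left edge. *)
      let ?S = "{a. 1 < i \<and> i \<in># a}"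
      obtain q r where qr: "p (Vtx i j) = q + r" "mons q = mons (p (Vtx i j)) \<inter> ?S"
        "mons r = mons (p (Vtx i j)) - ?S" by (rule split_mons)
      have qr_polys: "q \<in> polys n" "r \<in> polys n"
        using Suc.prems(1)[of "Vtx i j"] qr by (auto simp: mem_polys)
      have q: "var i * var_quot i q = q" by (rule var_mult_var_quot) (use qr(2) in auto)
      have r: "var j * var_quot j r = r"
        by (rule var_mult_var_quot)
          (use vertex_syzygy_leading_coefficient[OF Suc.prems(2,3) box lead] qr(3) in blast)
      have q0: "q = 0" if "i = 1" using qr(2) that by (metis Collect_empty_eq inf_bot_right keys_eq_empty less_irrefl)
      have r0: "r = 0" if "i = j"
      proof -
        have "mons r = {}"
          using vertex_syzygy_leading_coefficient[OF Suc.prems(2,3) box lead] qr(3) that by blast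
        then show ?thesis by simp
      qed
      (* The chain of edges whose boundary has the same coefficient at the point (i, j) as p and
         is supported on that point and earlier ones. *)
      define z where "z c = (if c = Hor i (j - 1) \<and> i < j then var_quot j r
        else if c = Ver (i - 1) j \<and> 1 < i then var_quot i q else 0)" for c
      have z_polys: "z c \<in> polys n" for c using qr_polys by (simp add: z_def)
      have z0: "z c = 0" if "\<not> valid c" for c
        using that box ij by (auto simp: z_def)
      define p' where "p' v = (if v \<in> cells 1 then p v - (\<Sum>e\<in>cells 2. bd top e v * z e) else 0)" for v
      have bd_polys: "(bd top e v :: 'k mpoly) \<in> polys n" if "e \<in> cells 2" "v \<in> cells 1" for e v
        by (rule bd_graded_minimal[of e 1 v, THEN conjunct1]) (use that in \<open>simp_all add: numeral_2_eq_2\<close>)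
      have p'_Vtx: "p' (Vtx k l) = p (Vtx k l) - (var l * (z (Hor k (l - 1)) - z (Hor k l))
          + var k * (z (Ver (k - 1) l) - z (Ver k l)))" if "box k l" for k l
        using that box_ge[OF that] sum_bd_Vtx[OF z0, where k = k and l = l and t = top] by (simp add: p'_def)
      have "\<exists>w. (\<forall>c. w c \<in> polys n) \<and> (\<forall>v\<in>cells 1. p' v = (\<Sum>e\<in>cells 2. bd top e v * w e))"
      proof (rule Suc.IH)
        show "p' v \<in> polys n" for v
        proof (cases "v \<in> cells 1")
          case True
          then have "(\<Sum>e\<in>cells 2. bd top e v * z e) \<in> polys n"
            by (intro polys_sum polys_closed(4) bd_polys z_polys)
          then show ?thesis unfolding p'_def using True Suc.prems(1) by (simp del: in_cells)
        qed (simp add: p'_def del: in_cells)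
        show "p' v = 0" if "v \<notin> cells 1" for v unfolding p'_def by (rule if_not_P[OF that])
        have "(\<Sum>v\<in>cells 1. bd top v Whole * p' v)
          = (\<Sum>v\<in>cells 1. bd top v Whole * p v) - (\<Sum>v\<in>cells 1. \<Sum>e\<in>cells 2. bd top v Whole * (bd top e v * z e))"
          by (simp add: p'_def right_diff_distrib sum_subtractf sum_distrib_left del: in_cells)
        also have "(\<Sum>v\<in>cells 1. \<Sum>e\<in>cells 2. bd top v Whole * (bd top e v * z e))
          = (\<Sum>e\<in>cells 2. (\<Sum>v\<in>cells 1. bd top e v * bd top v Whole) * z e)"
          unfolding sum_distrib_right by (subst sum.swap) (simp add: mult_ac)
        also have "\<dots> = 0" by (intro sum.neutral ballI) (simp only: bd_bd_edge mult_zero_left)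
        finally show "(\<Sum>v\<in>cells 1. bd top v Whole * p' v) = 0" using Suc.prems(3) by simp
        show "p' (Vtx k l) = 0" if kl: "box k l" "N \<le> k * Suc n + l" for k l
        proof -
          have kl_pos: "1 \<le> k" "1 \<le> l" using box_ge[OF kl(1)] by auto
          have kl_n: "l \<le> n" using box_le[OF kl(1)] .
          consider "k = i" "l = j" | "i < k \<or> (i = k \<and> j < l)" | "k < i \<or> (k = i \<and> l < j)"
            by linarith
          then show ?thesis
          proof cases
            case 1
            have "z (Hor i j) = 0" "z (Ver i j) = 0" using ij by (auto simp: z_def)
            moreover have "var j * z (Hor i (j - 1)) = r"
              using r r0 ij by (cases "i < j") (auto simp: z_def)
            moreover have "var i * z (Ver (i - 1) j) = q"
              using q q0 ij by (cases "1 < i") (auto simp: z_def)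
            ultimately show ?thesis unfolding 1 p'_Vtx[OF box] qr(1) by simp
          next
            case 2
            then have "z (Hor k (l - 1)) = 0" "z (Hor k l) = 0" "z (Ver (k - 1) l) = 0" "z (Ver k l) = 0"
              using ij kl_pos by (auto simp: z_def)
            then show ?thesis using p'_Vtx[OF kl(1)] lead[OF kl(1) 2] by simp
          next
            case 3
            have "k * Suc n + l < i * Suc n + j"
            proof (cases "k < i")
              case True
              then have "Suc k * Suc n \<le> i * Suc n" by (intro mult_right_mono) auto
              then show ?thesis using kl_n ij by simp
            qed (use 3 in auto)
            then show ?thesis using kl(2) N by simp
          qed
        qed
      qed
      then obtain w where w: "\<And>c. w c \<in> polys n"
        "\<And>v. v \<in> cells 1 \<Longrightarrow> p' v = (\<Sum>e\<in>cells 2. bd top e v * w e)" by blast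
      have "p v = (\<Sum>e\<in>cells 2. bd top e v * (w e + z e))" if v: "v \<in> cells 1" for v
      proof -
        have "p v = p' v + (\<Sum>e\<in>cells 2. bd top e v * z e)" using v by (simp add: p'_def del: in_cells)
        then show ?thesis unfolding w(2)[OF v] by (simp add: distrib_left sum.distrib)
      qed
      then show ?thesis using w(1) z_polys by (intro exI[of _ "\<lambda>c. w c + z c"]) auto
    qed
  qed
  moreover have "p (Vtx k l) = 0" if "box k l" "n * Suc n + Suc n \<le> k * Suc n + l" for k l
  proof -
    have "k \<le> n" "l \<le> n" using box_ge[OF that(1)] box_le[OF that(1)] by auto
    then have "k * Suc n \<le> n * Suc n" by (intro mult_right_mono) auto
    with \<open>l \<le> n\<close> that(2) show ?thesis by simp
  qed
  ultimately show ?thesis using assms by blast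
qed

section \<open>Betti numbers of the ideal of a shifted diagram\<close>

text \<open>
  As there are no cells above the squares, the exactness results at points, edges and
  squares cover all degrees.
\<close>

theorem betti_dual_ideal:
  "betti n (Idl\<^bsub>poly_ring n\<^esub> {monomial (top - {#i, j#}) :: 'k::field mpoly | i j. box i j}) d = card (cells d)"
proof (rule betti_eq_card_cells[where M = "bd top" and ?c0.0 = Whole and deg = "cell_degree top"])
  show "finite (cells i)" for i by (rule finite_cells)
  show "cells 0 = {Whole}" by (rule cells_0)
  show "cell_degree top Whole = 0" by simp
  show "(bd top c c' :: 'k mpoly) \<in> polys n \<and> homogeneous (cell_degree top c - cell_degree top c') (bd top c c' :: 'k mpoly) \<and>
      const_coef (bd top c c' :: 'k mpoly) = 0" if "c \<in> cells (Suc i)" "c' \<in> cells i" for i c c'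
    using that by (rule bd_graded_minimal)
  show "Idl\<^bsub>poly_ring n\<^esub> {monomial (top - {#i, j#}) | i j. box i j}
      = Idl\<^bsub>poly_ring n\<^esub> ((\<lambda>c. bd top c Whole) ` cells 1 :: 'k mpoly set)"
  proof (rule arg_cong[of _ _ "genideal _"], intro equalityI subsetI)
    fix x assume "x \<in> (\<lambda>c. bd top c Whole) ` cells 1"
    then obtain c where "c \<in> cells 1" "x = bd top c Whole" by blast
    then show "x \<in> {monomial (top - {#i, j#}) | i j. box i j}" by (cases c) auto
  next
    fix x :: "'k mpoly" assume "x \<in> {monomial (top - {#i, j#}) | i j. box i j}"
    then obtain i j where "x = bd top (Vtx i j) Whole" "Vtx i j \<in> cells 1" by auto
    then show "x \<in> (\<lambda>c. bd top c Whole) ` cells 1" by blast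
  qed
  show "(\<Sum>c'\<in>cells (Suc i). bd top c c' * bd top c' c'') = (0 :: 'k mpoly)"
    if "c \<in> cells (Suc (Suc i))" "c'' \<in> cells i" for i c c''
  proof -
    consider "i = 0" | "i = 1" | "2 \<le> i" by linarith
    then show ?thesis
    proof cases
      case 1
      with that cells_0 have "c'' = Whole" "c \<in> cells 2" by (auto simp: numeral_2_eq_2)
      then show ?thesis using bd_bd_edge[of c, where ?'k = 'k] 1 by simp
    next
      case 2
      then show ?thesis using bd_bd_square[of c c'' top, where ?'k = 'k] that by (simp add: numeral_2_eq_2 numeral_3_eq_3)
    next
      case 3
      then obtain i' where "i = 2 + i'" using le_Suc_ex by blast
      then have "cells (Suc (Suc i)) = {}" using cells_ge_4[of i'] by simp
      then show ?thesis using that(1) by blast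
    qed
  qed
  show "\<exists>w. (\<forall>c. w c \<in> polys n) \<and> (\<forall>c\<in>cells (Suc i). v c = (\<Sum>c''\<in>cells (Suc (Suc i)). bd top c'' c * w c''))"
    if v: "\<And>c. v c \<in> (polys n :: 'k mpoly set)" "\<And>c. c \<notin> cells (Suc i) \<Longrightarrow> v c = 0"
      "\<And>c'. c' \<in> cells i \<Longrightarrow> (\<Sum>c\<in>cells (Suc i). bd top c c' * v c) = 0" for i v
  proof -
    consider "i = 0" | "i = 1" | "i = 2" | "3 \<le> i" by linarith
    then show ?thesis
    proof cases
      case 1
      then show ?thesis using exact_vertices[of v] v by (simp add: cells_0 numeral_2_eq_2 del: in_cells)
    next
      case 2
      then show ?thesis using exact_edges[of v top] v by (simp add: numeral_2_eq_2 numeral_3_eq_3 del: in_cells)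
    next
      case 3
      then have "v c = 0" for c
        using exact_squares[of v top c] v by (simp add: numeral_2_eq_2 numeral_3_eq_3 del: in_cells)
      then show ?thesis by (intro exI[of _ "\<lambda>_. 0"]) auto
    next
      case 4
      then obtain i' where "i = 3 + i'" using le_Suc_ex by blast
      then have "cells (Suc i) = {}" using cells_ge_4[of i'] by (simp add: numeral_3_eq_3)
      then show ?thesis by (intro exI[of _ "\<lambda>_. 0"]) simp
    qed
  qed
qed

end

section \<open>Ideals generated in one degree\<close>

text \<open>
  A nonconstant monomial of \<open>q\<close> raises the degree above that of
  \<open>g\<close>, so only the constant term of \<open>q\<close> contributes.
\<close>

lemma coef_mult_least_degree:
  fixes p q :: "'k::field mpoly"
  assumes "\<And>a. a \<in> mons p \<Longrightarrow> size g \<le> size a"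
  shows "coef (p * q) g = const_coef q * coef p g"
proof -
  define q' where "q' = q - Poly_Mapping.single 0 (const_coef q)"
  have q: "q = Poly_Mapping.single 0 (const_coef q) + q'" by (simp add: q'_def)
  have "g \<notin> mons (p * q')"
  proof
    assume "g \<in> mons (p * q')"
    then obtain a b where ab: "g = a + b" "a \<in> mons p" "b \<in> mons q'" using keys_mult[of p q'] by blast
    with assms[of a] have "b = {#}" by simp
    moreover have "{#} \<notin> mons q'" by (simp add: mons_iff q'_def lookup_minus lookup_single)
    ultimately show False using ab by simp
  qed
  then have "coef (p * q') g = 0" by (simp add: mons_iff)
  moreover have "p * q = Poly_Mapping.single 0 (const_coef q) * p + p * q'"
    using arg_cong[OF q, of "(*) p"] by (simp add: algebra_simps)
  ultimately show ?thesis by (simp add: lookup_add coef_const_mult)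
qed

text \<open>
  With fewer than \<open>card G\<close> generators \<open>S\<close>, some nonzero linear
  form on the degree-\<open>d\<close> part of the ideal kills \<open>S\<close>. It then
  kills every element of degree \<open>d\<close> of the ideal, in particular the monomials
  in \<open>G\<close>, so all its coefficients vanish.
\<close>

lemma min_num_gens_equigenerated:
  assumes fin: "finite G" and G: "\<And>g. g \<in> G \<Longrightarrow> set_mset g \<subseteq> {1..n} \<and> size g = d"
  shows "min_num_gens (poly_ring n) (Idl\<^bsub>poly_ring n\<^esub> (monomial ` G :: 'k::field mpoly set)) = card G"
  unfolding min_num_gens_def
proof (rule Least_equality)
  have "inj_on (monomial :: _ \<Rightarrow> 'k mpoly) G"
    by (rule inj_onI) (metis coef_monomial one_neq_zero)
  then show "\<exists>S. finite S \<and> card S = card G \<and> S \<subseteq> polys n \<and>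
      Idl\<^bsub>poly_ring n\<^esub> (monomial ` G :: 'k mpoly set) = Idl\<^bsub>poly_ring n\<^esub> S"
    using fin G by (intro exI[of _ "monomial ` G"]) (auto simp: card_image)
next
  fix k assume "\<exists>S. finite S \<and> card S = k \<and> S \<subseteq> polys n \<and>
      Idl\<^bsub>poly_ring n\<^esub> (monomial ` G :: 'k mpoly set) = Idl\<^bsub>poly_ring n\<^esub> S"
  then obtain S :: "'k mpoly set" where S: "finite S" "card S = k" "S \<subseteq> polys n"
    and eq: "Idl\<^bsub>poly_ring n\<^esub> (monomial ` G) = Idl\<^bsub>poly_ring n\<^esub> S" by blast
  show "card G \<le> k"
  proof (rule ccontr)
    assume "\<not> card G \<le> k"
    with S(2) have "card S < card G" by simp
    from nontrivial_solution[OF S(1) fin this, of coef] obtain c where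
      c: "\<exists>g\<in>G. c g \<noteq> 0" "\<And>s. s \<in> S \<Longrightarrow> (\<Sum>g\<in>G. coef s g * c g) = 0" by blast
    have deg: "d \<le> size a" if sa: "s \<in> S" "a \<in> mons s" for s a
    proof -
      have "s \<in> Idl\<^bsub>poly_ring n\<^esub> (monomial ` G)" unfolding eq using R.genideal_self[OF S(3)] sa(1) by blast
      also have "\<dots> = {p. p \<in> polys n \<and> (\<forall>a\<in>mons p. \<exists>g\<in>G. g \<subseteq># a)}"
        by (rule Idl_monomials_eq) (use G in auto)
      finally obtain g where "g \<in> G" "g \<subseteq># a" using sa(2) by blast
      then show ?thesis using G size_mset_mono by metis
    qed
    have "c g = 0" if g: "g \<in> G" for g
    proof -
      have sub: "monomial ` G \<subseteq> (polys n :: 'k mpoly set)" using G by auto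
      have "monomial g \<in> Idl\<^bsub>poly_ring n\<^esub> (id ` S)"
        using R.genideal_self[OF sub] g unfolding eq by auto
      also have "\<dots> = {\<Sum>s\<in>S. id s * w s | w. \<forall>s. w s \<in> polys n}"
        by (rule Idl_finite_eq_combinations) (use S in auto)
      finally obtain w where w: "monomial g = (\<Sum>s\<in>S. s * w s)" by auto
      have coefs: "coef (monomial g) h = (\<Sum>s\<in>S. const_coef (w s) * coef s h)" if "h \<in> G" for h
        unfolding w lookup_sum using deg G[OF that] by (intro sum.cong refl coef_mult_least_degree) auto
      have "c g = (\<Sum>h\<in>G. coef (monomial g) h * c h)"
        using fin g by (simp add: coef_monomial if_distrib[of "\<lambda>x. x * _"] cong: if_cong)
      also have "\<dots> = (\<Sum>h\<in>G. \<Sum>s\<in>S. const_coef (w s) * (coef s h * c h))"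
        by (intro sum.cong refl) (simp add: coefs sum_distrib_right mult.assoc)
      also have "\<dots> = (\<Sum>s\<in>S. const_coef (w s) * (\<Sum>h\<in>G. coef s h * c h))"
        by (subst sum.swap) (simp add: sum_distrib_left)
      also have "\<dots> = 0" using c(2) by simp
      finally show ?thesis .
    qed
    with c(1) show False by blast
  qed
qed

section \<open>The strongly stable ideal and its LCM-dual\<close>

lemma sum_int_upto: "(\<Sum>i=1..m. int i) = int ((m + 1) choose 2)"
  by (induction m) (simp_all add: numeral_2_eq_2)

locale strongly_stable_shape =
  fixes lam :: "nat \<Rightarrow> nat" and m n :: nat
  assumes m_pos: "1 \<le> m"
    and lam_decr: "\<And>i j. 1 \<le> i \<Longrightarrow> i \<le> j \<Longrightarrow> j \<le> m \<Longrightarrow> lam j \<le> lam i"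
    and m_le_lam: "m \<le> lam m"
    and n_def: "n = lam 1"
    and n_ge: "2 \<le> n"
begin

definition box :: "nat \<Rightarrow> nat \<Rightarrow> bool" where
  "box i j \<longleftrightarrow> 1 \<le> i \<and> i \<le> m \<and> i \<le> j \<and> j \<le> lam i"

definition gens :: "nat multiset set" where
  "gens = {{#i, j#} | i j. box i j}"

lemma lam_ge: "1 \<le> i \<Longrightarrow> i \<le> m \<Longrightarrow> m \<le> lam i"
  using lam_decr[of i m] m_le_lam by simp

lemma lam_le: "1 \<le> i \<Longrightarrow> i \<le> m \<Longrightarrow> lam i \<le> n"
  using lam_decr[of 1 i] n_def by simp

lemma m_le_n: "m \<le> n"
  using lam_ge[of 1] m_pos n_def by simp

lemma box_range: "box i j \<Longrightarrow> i \<in> {1..n} \<and> j \<in> {1..n}"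
  using lam_le[of i] by (auto simp: box_def)

lemma gens_vars: "g \<in> gens \<Longrightarrow> set_mset g \<subseteq> {1..n}"
  using box_range by (fastforce simp: gens_def)

lemma gens_size: "g \<in> gens \<Longrightarrow> size g = 2"
  by (auto simp: gens_def)

lemma ideal_eq_Idl_gens: "strongly_stable_ideal n m lam = Idl\<^bsub>poly_ring n\<^esub> (monomial ` gens)"
  unfolding strongly_stable_ideal_def gens_def box_def
  by (rule arg_cong[of _ _ "genideal _"]) auto

lemma mem_ideal_iff:
  "p \<in> strongly_stable_ideal n m lam \<longleftrightarrow> p \<in> polys n \<and> (\<forall>a\<in>mons p. \<exists>g\<in>gens. g \<subseteq># a)"
  unfolding ideal_eq_Idl_gens using Idl_monomials_eq[OF gens_vars] by blast

lemma min_mono_gens_eq: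
  "min_mono_gens (strongly_stable_ideal n m lam :: 'k::field mpoly set) = gens"
proof -
  have mono: "(monomial a :: 'k mpoly) \<in> strongly_stable_ideal n m lam \<longleftrightarrow>
    set_mset a \<subseteq> {1..n} \<and> (\<exists>g\<in>gens. g \<subseteq># a)" for a
    by (simp add: mem_ideal_iff)
  show ?thesis
  proof (intro equalityI subsetI)
    fix a assume "a \<in> min_mono_gens (strongly_stable_ideal n m lam :: 'k mpoly set)"
    then have a: "\<exists>g\<in>gens. g \<subseteq># a"
      and min: "\<And>b. (monomial b :: 'k mpoly) \<in> strongly_stable_ideal n m lam \<Longrightarrow> b \<subseteq># a \<Longrightarrow> b = a"
      by (auto simp: min_mono_gens_def mono)
    then obtain g where "g \<in> gens" "g \<subseteq># a" by blast
    moreover from this have "(monomial g :: 'k mpoly) \<in> strongly_stable_ideal n m lam"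
      using gens_vars unfolding mono by blast
    ultimately show "a \<in> gens" using min by blast
  next
    fix a assume a: "a \<in> gens"
    have "b = a" if "(monomial b :: 'k mpoly) \<in> strongly_stable_ideal n m lam" "b \<subseteq># a" for b
    proof -
      from that(1) obtain g where g: "g \<in> gens" "g \<subseteq># b" unfolding mono by blast
      then have "size a \<le> size b" using gens_size[OF a] gens_size[OF g(1)] size_mset_mono[OF g(2)] by simp
      then show ?thesis using that(2) by (metis leD mset_subset_size subset_mset.le_imp_less_or_eq)
    qed
    then show "a \<in> min_mono_gens (strongly_stable_ideal n m lam :: 'k mpoly set)"
      using a gens_vars by (auto simp: min_mono_gens_def mono)
  qed
qed

lemma box_1: "1 \<le> j \<Longrightarrow> j \<le> n \<Longrightarrow> box 1 j"
  using m_pos n_def by (simp add: box_def)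

lemma gens_bounded:
  "g \<in> gens \<Longrightarrow> g \<subseteq># mset_set {1..n} + mset_set {1..n}"
proof -
  assume "g \<in> gens"
  then obtain i j where "g = {#i#} + {#j#}" "i \<in> {1..n}" "j \<in> {1..n}"
    using box_range by (fastforce simp: gens_def)
  moreover have "{#k#} \<subseteq># mset_set {1..n}" if "k \<in> {1..n}" for k
    using that by simp
  ultimately show ?thesis using subset_mset.add_mono by blast
qed

lemma gens_le_lcm: "g \<in> gens \<Longrightarrow> g \<subseteq># Sup gens"
  by (rule subset_mset.cSup_upper) (use gens_bounded in \<open>auto intro: subset_mset.bdd_aboveI\<close>)

lemma gens_nonempty: "{#1, 1#} \<in> gens" "{#1, 2#} \<in> gens"
proof -
  have "box 1 1" "box 1 2" using box_1 n_ge by simp_all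
  then show "{#1, 1#} \<in> gens" "{#1, 2#} \<in> gens" unfolding gens_def by blast+
qed

lemma lcm_vars: "set_mset (Sup gens) \<subseteq> {1..n}"
proof -
  have "Sup gens \<subseteq># mset_set {1..n} + mset_set {1..n}"
    by (rule subset_mset.cSup_least) (use gens_bounded gens_nonempty in auto)
  then show ?thesis using set_mset_mono by fastforce
qed

text \<open>
  The dual ideal is proper: \<open>x\<^sub>1\<^sup>2\<close> and
  \<open>x\<^sub>1 x\<^sub>2\<close> are both generators, so the least common multiple is
  not itself one of the generators. This needs two variables.
\<close>

lemma gens_less_lcm:
  assumes g: "g \<in> gens"
  shows "g \<subset># Sup gens"
proof -
  have "g \<noteq> Sup gens"
  proof
    assume "g = Sup gens"
    then have "h = g" if "h \<in> gens" for h
      using gens_le_lcm[OF that] gens_size[OF that] gens_size[OF g]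
      by (metis mset_subset_size nat_less_le subset_mset.le_imp_less_or_eq)
    then have "{#1, 1#} = ({#1, 2#} :: nat multiset)" using gens_nonempty by metis
    then show False by simp
  qed
  with gens_le_lcm[OF g] show ?thesis by (simp add: subset_mset.less_le)
qed

sublocale shifted_diagram n box "Sup gens"
proof
  show "1 \<le> i \<and> i \<le> j" if "box i j" for i j using that by (simp add: box_def)
  show "j \<le> n" if "box i j" for i j using box_range[OF that] by simp
  show "box i j" if "box (Suc i) j" "1 \<le> i" for i j
    using that lam_decr[of i "Suc i"] by (auto simp: box_def)
  show "box i j" if "box i (Suc j)" "i \<le> j" for i j using that by (simp add: box_def)
  show "{#i, j#} \<subset># Sup gens" if "box i j" for i j
    using gens_less_lcm that unfolding gens_def by blast
  show "set_mset (Sup gens) \<subseteq> {1..n}" by (rule lcm_vars)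
qed

lemma betti_lcm_dual:
  "betti n (lcm_dual n (strongly_stable_ideal n m lam :: 'k::field mpoly set)) d = card (cells d)"
proof -
  have "{monomial (Sup gens - f) | f. f \<in> gens} = {monomial (Sup gens - {#i, j#}) :: 'k mpoly | i j. box i j}"
    unfolding gens_def by blast
  then show ?thesis
    unfolding lcm_dual_def min_mono_gens_eq using betti_dual_ideal[of d, where ?'k = 'k] by simp
qed

lemma finite_gens: "finite gens"
proof -
  have "gens \<subseteq> (\<lambda>(i, j). {#i, j#}) ` ({1..n} \<times> {1..n})"
    using box_range by (fastforce simp: gens_def)
  then show ?thesis by (rule finite_subset) simp
qed

lemma card_gens: "card gens = card (cells 1)"
proof -
  have "bij_betw (\<lambda>c. case c of Vtx i j \<Rightarrow> {#i, j#} | _ \<Rightarrow> {#}) (cells 1) gens"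
  proof (rule bij_betwI')
    fix c c' assume c: "c \<in> cells 1" "c' \<in> cells 1"
    then obtain i j k l where "c = Vtx i j" "c' = Vtx k l" by (cases c; cases c') auto
    moreover from this c have "i \<le> j" "k \<le> l" by (auto simp: box_def)
    ultimately show "((case c of Vtx i j \<Rightarrow> {#i, j#} | _ \<Rightarrow> {#}) = (case c' of Vtx i j \<Rightarrow> {#i, j#} | _ \<Rightarrow> {#})) = (c = c')"
      by (auto simp: add_eq_conv_ex)
  next
    fix c assume "c \<in> cells 1"
    then show "(case c of Vtx i j \<Rightarrow> {#i, j#} | _ \<Rightarrow> {#}) \<in> gens" by (cases c) (auto simp: gens_def)
  next
    fix g assume "g \<in> gens"
    then obtain i j where "g = {#i, j#}" "box i j" by (auto simp: gens_def)
    then show "\<exists>c\<in>cells 1. g = (case c of Vtx i j \<Rightarrow> {#i, j#} | _ \<Rightarrow> {#})"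
      by (intro bexI[of _ "Vtx i j"]) auto
  qed
  then show ?thesis by (simp add: bij_betw_same_card)
qed

lemma min_num_gens_eq:
  "min_num_gens (poly_ring n) (strongly_stable_ideal n m lam :: 'k::field mpoly set) = card (cells 1)"
  unfolding ideal_eq_Idl_gens card_gens[symmetric]
  by (rule min_num_gens_equigenerated[OF finite_gens]) (use gens_vars gens_size in blast)

lemma height_eq:
  "ideal_height (poly_ring n) (strongly_stable_ideal n m lam :: 'k::field mpoly set) = enat m"
proof (rule ideal_height_eq[OF _ _ m_le_n])
  show "(strongly_stable_ideal n m lam :: 'k mpoly set) \<subseteq> var_prime n m"
  proof
    fix p :: "'k mpoly" assume p: "p \<in> strongly_stable_ideal n m lam"
    have "set_mset a \<inter> {1..m} \<noteq> {}" if a: "a \<in> mons p" for a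
    proof -
      obtain h where "h \<in> gens" "h \<subseteq># a"
        using iffD1[OF mem_ideal_iff p] a by blast
      then obtain i j where "box i j" "{#i, j#} \<subseteq># a" unfolding gens_def by blast
      then have "i \<in> {1..m}" "i \<in># a" by (auto simp: box_def dest: mset_subset_eqD)
      then show ?thesis by blast
    qed
    then show "p \<in> var_prime n m" using p by (simp add: var_prime_def mem_ideal_iff)
  qed
  show "(var i * var i :: 'k mpoly) \<in> strongly_stable_ideal n m lam" if i: "1 \<le> i" "i \<le> m" for i
  proof -
    have "box i i" using i lam_ge[of i] by (simp add: box_def)
    then have "{#i, i#} \<in> gens" unfolding gens_def by blast
    then have "(monomial {#i, i#} :: 'k mpoly) \<in> strongly_stable_ideal n m lam"
      using gens_vars[of "{#i, i#}"] by (auto simp: mem_ideal_iff)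
    then show ?thesis by (simp flip: monomial_add)
  qed
qed

lemma card_row:
  assumes "1 \<le> i" "i \<le> m"
  shows "int (card {i..lam i}) = int (lam i) - int i + 1" and "int (card {i..<lam i}) = int (lam i) - int i"
  using lam_ge[OF assms] assms by (simp_all add: of_nat_diff)

lemma card_cells_1: "int (card (cells 1)) = (\<Sum>i=1..m. int (lam i) - int i + 1)"
proof -
  have "cells 1 = (\<lambda>(i, j). Vtx i j) ` (SIGMA i:{1..m}. {i..lam i})"
  proof (intro equalityI subsetI)
    fix c assume "c \<in> cells 1"
    then show "c \<in> (\<lambda>(i, j). Vtx i j) ` (SIGMA i:{1..m}. {i..lam i})"
      by (cases c) (auto simp: box_def)
  qed (auto simp: box_def)
  then have "card (cells 1) = (\<Sum>i=1..m. card {i..lam i})"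
    by (simp add: card_image inj_on_def)
  also have "int \<dots> = (\<Sum>i=1..m. int (lam i) - int i + 1)"
    unfolding of_nat_sum by (intro sum.cong refl card_row) auto
  finally show ?thesis .
qed

text \<open>
  A vertical edge is counted in the row of its lower end: every box below row 1 has an upper
  neighbour.
\<close>

lemma card_cells_2: "int (card (cells 2)) =
  (\<Sum>i=1..m. int (lam i) - int i) + (\<Sum>i=2..m. int (lam i) - int i + 1)"
proof -
  let ?H = "(\<lambda>(i, j). Hor i j) ` (SIGMA i:{1..m}. {i..<lam i})"
  let ?V = "(\<lambda>(i, j). Ver (i - 1) j) ` (SIGMA i:{2..m}. {i..lam i})"
  have "cells 2 = ?H \<union> ?V"
  proof (intro equalityI subsetI)
    fix c assume "c \<in> cells 2"
    then show "c \<in> ?H \<union> ?V"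
      by (cases c) (auto simp: box_def image_iff Bex_def intro: exI[of _ "Suc _"])
  qed (auto simp: box_def)
  moreover have "?H \<inter> ?V = {}" by auto
  moreover have "card ?H = (\<Sum>i=1..m. card {i..<lam i})"
    by (simp add: card_image inj_on_def)
  moreover have "inj_on (\<lambda>(i, j). Ver (i - 1) j) (SIGMA i:{2..m}. {i..lam i})"
    by (auto simp: inj_on_def)
  then have "card ?V = (\<Sum>i=2..m. card {i..lam i})"
    by (simp add: card_image)
  ultimately have "card (cells 2) = (\<Sum>i=1..m. card {i..<lam i}) + (\<Sum>i=2..m. card {i..lam i})"
    by (simp add: card_Un_disjoint)
  also have "int \<dots> = (\<Sum>i=1..m. int (lam i) - int i) + (\<Sum>i=2..m. int (lam i) - int i + 1)"
    unfolding of_nat_sum of_nat_add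
    by (intro arg_cong2[of _ _ _ _ "(+)"] sum.cong refl card_row) auto
  finally show ?thesis .
qed

lemma card_cells_3: "int (card (cells 3)) = (\<Sum>i=2..m. int (lam i) - int i)"
proof -
  let ?S = "(\<lambda>(i, j). Sq (i - 1) j) ` (SIGMA i:{2..m}. {i..<lam i})"
  have "cells 3 = ?S"
  proof (intro equalityI subsetI)
    fix c assume "c \<in> cells 3"
    then show "c \<in> ?S"
      by (cases c) (auto simp: box_def image_iff Bex_def intro: exI[of _ "Suc _"])
  qed (auto simp: box_def)
  moreover have "inj_on (\<lambda>(i, j). Sq (i - 1) j) (SIGMA i:{2..m}. {i..<lam i})"
    by (auto simp: inj_on_def)
  ultimately have "card (cells 3) = (\<Sum>i=2..m. card {i..<lam i})"
    by (simp add: card_image)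
  also have "int \<dots> = (\<Sum>i=2..m. int (lam i) - int i)"
    unfolding of_nat_sum by (intro sum.cong refl card_row) auto
  finally show ?thesis .
qed

end

section \<open>The Betti numbers of the LCM-dual\<close>

theorem proposition4p12:
  fixes lam :: "nat \<Rightarrow> nat" and m n g :: nat
    and I :: "'k::field mpoly set" and \<beta> :: "nat \<Rightarrow> nat" and \<mu> :: nat
  assumes "1 \<le> m"
    and "\<forall>i j. 1 \<le> i \<and> i \<le> j \<and> j \<le> m \<longrightarrow> lam j \<le> lam i"
    and "m \<le> lam m"
    and "n = lam 1"
    and "2 \<le> n"
    and "I = strongly_stable_ideal n m lam"
    and "\<beta> = betti n (lcm_dual n I)"
    and "\<mu> = min_num_gens (poly_ring n) I"
    and "g = the_enat (ideal_height (poly_ring n) I)"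
  shows "int (\<beta> 1) = (\<Sum>i=1..m. int (lam i)) - int (m choose 2)
    \<and> int (\<beta> 2) = int (lam 1) + 2 * (\<Sum>i=2..m. int (lam i)) - int m ^ 2
    \<and> int (\<beta> 3) = (\<Sum>i=2..m. int (lam i)) - int ((m + 1) choose 2) + 1
    \<and> ideal_height (poly_ring n) I = enat g
    \<and> g = m
    \<and> \<beta> 1 = \<mu>
    \<and> int (\<beta> 2) = 2 * int \<mu> - int g - int n
    \<and> int (\<beta> 3) = int \<mu> - int g - int n + 1"
proof -
  interpret strongly_stable_shape lam m n
    using assms(1-5) by unfold_locales auto
  have \<beta>: "\<beta> d = card (cells d)" for d
    unfolding assms(6,7) by (rule betti_lcm_dual)
  have \<mu>: "\<mu> = card (cells 1)" unfolding assms(6,8) by (rule min_num_gens_eq)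
  have height: "ideal_height (poly_ring n) I = enat m" unfolding assms(6) by (rule height_eq)
  then have g: "g = m" using assms(9) by simp
  define S where "S = (\<Sum>i=2..m. int (lam i))"
  define T where "T = int ((m + 1) choose 2)"
  have sum1: "(\<Sum>i=1..m. f i) = f 1 + (\<Sum>i=2..m. f i)" for f :: "nat \<Rightarrow> int"
    using m_pos by (simp add: sum.atLeast_Suc_atMost numeral_2_eq_2)
  have T1: "(\<Sum>i=1..m. int i) = T" unfolding T_def by (rule sum_int_upto)
  then have T2: "(\<Sum>i=2..m. int i) = T - 1" using sum1[of int] by simp
  have lam1: "(\<Sum>i=1..m. int (lam i)) = int n + S" using sum1[of "\<lambda>i. int (lam i)"] n_def by (simp add: S_def)
  have choose2: "int (m choose 2) = T - int m" by (simp add: T_def numeral_2_eq_2)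
  have TT: "2 * T = int m ^ 2 + int m"
  proof -
    have "even (m * (m + 1))" by simp
    then have "2 * ((m + 1) choose 2) = m * (m + 1)" unfolding choose_two by (simp add: mult.commute)
    then have "2 * T = int (m * (m + 1))" unfolding T_def by (metis of_nat_mult of_nat_numeral)
    then show ?thesis by (simp add: power2_eq_square algebra_simps)
  qed
  have c1: "int (card (cells 1)) = int n + S - T + int m"
    unfolding card_cells_1 sum.distrib sum_subtractf T1 lam1 by simp
  have c2: "int (card (cells 2)) = (int n + S - T) + (S - (T - 1) + (int m - 1))"
    unfolding card_cells_2 sum.distrib sum_subtractf T1 T2 lam1 S_def[symmetric]
    using m_pos by (simp add: of_nat_diff)
  have c3: "int (card (cells 3)) = S - (T - 1)"
    unfolding card_cells_3 sum_subtractf T2 S_def[symmetric] ..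
  show ?thesis
    unfolding \<beta> \<mu> g height c1 c2 c3 lam1 choose2 S_def[symmetric] T_def[symmetric] n_def[symmetric]
    using TT by simp
qed

end
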